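(* Let $G$ be a graph on $n$ vertices with real weights on its vertices. A maximum vertex-weighted triangle of $G$ can be found by a randomized algorithm in $O(n^{(\omega+3)/2}\cdot \log n)$ expected worst-case time.
   Context: $\omega$ denotes the exponent of square matrix multiplication ($n\times n$ matrices can be multiplied in $O(n^\omega)$ arithmetic operations). The weight of a triangle is the sum of the weights of its three vertices. Computation is in the comparison/addition model for reals (no dependence on bit lengths). *)

theory Defs
  imports
    "HOL-Probability.Probability"
    "HOL-Library.Landau_Symbols"
    "Jordan_Normal_Form.Matrix"
begin

section \<open>A randomized word RAM with real registers\<close>

text \<open>
  The memory consists of arrays, named by natural numbers, of machine words and of real numbers.
  Programs are finite syntax trees that do not depend on the input size, so the algorithms are
  uniform, and they mention finitely many array names. A scalar variable is cell 0 of an array.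
\<close>

record state =
  imem :: "nat \<Rightarrow> int \<Rightarrow> int"
  rmem :: "nat \<Rightarrow> int \<Rightarrow> real"

datatype iexp =
    IConst int
  | IRead nat iexp
  | IAdd iexp iexp
  | ISub iexp iexp
  | IMul iexp iexp
  | IDiv iexp iexp
  | IMod iexp iexp

datatype rexp =
    RConst rat
  | RRead nat iexp
  | RAdd rexp rexp
  | RSub rexp rexp
  | RMul rexp rexp

datatype bexp =
    ILe iexp iexp
  | RLe rexp rexp
  | BNot bexp
  | BAnd bexp bexp

text \<open>
  \<open>IWrite a i e\<close> and \<open>RWrite a i e\<close> store the value of \<open>e\<close> in cell \<open>i\<close> of array \<open>a\<close>;
  \<open>IRand a i e\<close> stores there a uniformly random element of \<open>{0..<e}\<close>.
\<close>

datatype com =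
    Skip
  | IWrite nat iexp iexp
  | RWrite nat iexp rexp
  | IRand nat iexp iexp
  | Seq com com
  | Cond bexp com com
  | While bexp com

primrec ival :: "iexp \<Rightarrow> state \<Rightarrow> int" where
  "ival (IConst k) s = k"
| "ival (IRead a i) s = imem s a (ival i s)"
| "ival (IAdd e f) s = ival e s + ival f s"
| "ival (ISub e f) s = ival e s - ival f s"
| "ival (IMul e f) s = ival e s * ival f s"
| "ival (IDiv e f) s = ival e s div ival f s"
| "ival (IMod e f) s = ival e s mod ival f s"

primrec rval :: "rexp \<Rightarrow> state \<Rightarrow> real" where
  "rval (RConst q) s = of_rat q"
| "rval (RRead a i) s = rmem s a (ival i s)"
| "rval (RAdd e f) s = rval e s + rval f s"
| "rval (RSub e f) s = rval e s - rval f s"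
| "rval (RMul e f) s = rval e s * rval f s"

primrec bval :: "bexp \<Rightarrow> state \<Rightarrow> bool" where
  "bval (ILe e f) s = (ival e s \<le> ival f s)"
| "bval (RLe e f) s = (rval e s \<le> rval f s)"
| "bval (BNot b) s = (\<not> bval b s)"
| "bval (BAnd b c) s = (bval b s \<and> bval c s)"

definition iwrite :: "nat \<Rightarrow> int \<Rightarrow> int \<Rightarrow> state \<Rightarrow> state" where
  "iwrite a i v s = s\<lparr>imem := (imem s)(a := (imem s a)(i := v))\<rparr>"

definition rwrite :: "nat \<Rightarrow> int \<Rightarrow> real \<Rightarrow> state \<Rightarrow> state" where
  "rwrite a i v s = s\<lparr>rmem := (rmem s)(a := (rmem s a)(i := v))\<rparr>"

text \<open>
  One step costs one unit of time. The expressions of a fixed program have bounded size, so the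
  number of steps is the number of elementary operations up to a constant factor. A halted
  computation (program \<open>Skip\<close>) stays where it is.
\<close>

primrec step :: "com \<Rightarrow> state \<Rightarrow> (com \<times> state) pmf" where
  "step Skip s = return_pmf (Skip, s)"
| "step (IWrite a i e) s = return_pmf (Skip, iwrite a (ival i s) (ival e s) s)"
| "step (RWrite a i e) s = return_pmf (Skip, rwrite a (ival i s) (rval e s) s)"
| "step (IRand a i e) s =
     map_pmf (\<lambda>v. (Skip, iwrite a (ival i s) v s))
       (if 0 < ival e s then pmf_of_set {0..<ival e s} else return_pmf 0)"
| "step (Seq c d) s =
     (if c = Skip then return_pmf (d, s)
      else map_pmf (\<lambda>(c', s'). (Seq c' d, s')) (step c s))"
| "step (Cond b c d) s = return_pmf (if bval b s then c else d, s)"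
| "step (While b c) s = return_pmf (if bval b s then Seq c (While b c) else Skip, s)"

primrec run :: "nat \<Rightarrow> com \<times> state \<Rightarrow> (com \<times> state) pmf" where
  "run 0 cs = return_pmf cs"
| "run (Suc t) cs = bind_pmf (step (fst cs) (snd cs)) (run t)"

definition reachable :: "com \<Rightarrow> state \<Rightarrow> (com \<times> state) set" where
  "reachable P s = (\<Union>t. set_pmf (run t (P, s)))"

text \<open>
  The expected value of the halting time \<open>T\<close>, as the sum over \<open>t\<close> of the probabilities that
  \<open>T > t\<close>; it is infinite if the program fails to halt with positive probability.
\<close>

definition expected_time :: "com \<Rightarrow> state \<Rightarrow> ennreal" where
  "expected_time P s = (\<Sum>t. emeasure (measure_pmf (run t (P, s))) {cs. fst cs \<noteq> Skip})"

text \<open>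
  Whatever the random choices, if the program halts then its final memory satisfies \<open>Q\<close>.
\<close>

definition always_yields :: "com \<Rightarrow> state \<Rightarrow> (state \<Rightarrow> bool) \<Rightarrow> bool" where
  "always_yields P s Q \<longleftrightarrow> (\<forall>s'. (Skip, s') \<in> reachable P s \<longrightarrow> Q s')"

definition words_bounded :: "int \<Rightarrow> com \<Rightarrow> state \<Rightarrow> bool" where
  "words_bounded B P s \<longleftrightarrow> (\<forall>(c, s') \<in> reachable P s. \<forall>a i. \<bar>imem s' a i\<bar> \<le> B)"

definition worst_case_expected_time :: "com \<Rightarrow> (nat \<Rightarrow> state set) \<Rightarrow> nat \<Rightarrow> ennreal" where
  "worst_case_expected_time P inputs n = (SUP s \<in> inputs n. expected_time P s)"

text \<open>
  \<open>inputs n\<close> is the set of initial memories for inputs of size \<open>n\<close>. The expectation is over the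
  random choices of the program, the supremum over the inputs. Integers in memory are
  words of \<open>O(log n)\<close> bits, i.e. polynomially bounded in \<open>n\<close>: unit-cost operations on integers of
  unbounded length would allow packing large amounts of data into one cell.
\<close>

definition runs_in_expected_time ::
    "com \<Rightarrow> (nat \<Rightarrow> state set) \<Rightarrow> (nat \<Rightarrow> real) \<Rightarrow> bool" where
  "runs_in_expected_time P inputs f \<longleftrightarrow>
     (\<exists>k. \<forall>n. \<forall>s \<in> inputs n. words_bounded ((int n + 2) ^ k) P s) \<and>
     (\<forall>n. worst_case_expected_time P inputs n < \<infinity>) \<and>
     (\<lambda>n. enn2real (worst_case_expected_time P inputs n)) \<in> O(f)"


section \<open>The comparison/addition model and arithmetic programs\<close>

text \<open>
  In the comparison/addition model real numbers may only be copied, added and compared.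
\<close>

primrec addition_rexp :: "rexp \<Rightarrow> bool" where
  "addition_rexp (RConst q) = False"
| "addition_rexp (RRead a i) = True"
| "addition_rexp (RAdd e f) = (addition_rexp e \<and> addition_rexp f)"
| "addition_rexp (RSub e f) = False"
| "addition_rexp (RMul e f) = False"

primrec addition_bexp :: "bexp \<Rightarrow> bool" where
  "addition_bexp (ILe e f) = True"
| "addition_bexp (RLe e f) = (addition_rexp e \<and> addition_rexp f)"
| "addition_bexp (BNot b) = addition_bexp b"
| "addition_bexp (BAnd b c) = (addition_bexp b \<and> addition_bexp c)"

primrec comparison_addition :: "com \<Rightarrow> bool" where
  "comparison_addition Skip = True"
| "comparison_addition (IWrite a i e) = True"
| "comparison_addition (RWrite a i e) = addition_rexp e"
| "comparison_addition (IRand a i e) = True"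
| "comparison_addition (Seq c d) = (comparison_addition c \<and> comparison_addition d)"
| "comparison_addition (Cond b c d) =
     (addition_bexp b \<and> comparison_addition c \<and> comparison_addition d)"
| "comparison_addition (While b c) = (addition_bexp b \<and> comparison_addition c)"

text \<open>
  Arithmetic programs are deterministic and perform ring operations on the data, with rational
  constants, but do not test the data. Thus on inputs of a given size they execute a fixed
  division-free arithmetic circuit over the rationals; divisions can be eliminated from
  circuits for matrix multiplication without changing the exponent (Strassen).
\<close>

primrec data_free :: "bexp \<Rightarrow> bool" where
  "data_free (ILe e f) = True"
| "data_free (RLe e f) = False"
| "data_free (BNot b) = data_free b"
| "data_free (BAnd b c) = (data_free b \<and> data_free c)"

primrec arithmetic :: "com \<Rightarrow> bool" where
  "arithmetic Skip = True"
| "arithmetic (IWrite a i e) = True"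
| "arithmetic (RWrite a i e) = True"
| "arithmetic (IRand a i e) = False"
| "arithmetic (Seq c d) = (arithmetic c \<and> arithmetic d)"
| "arithmetic (Cond b c d) = (data_free b \<and> arithmetic c \<and> arithmetic d)"
| "arithmetic (While b c) = (data_free b \<and> arithmetic c)"


section \<open>Matrix multiplication\<close>

text \<open>
  Initially cell 0 of word array 0 holds \<open>n\<close>, and the matrices are stored row by row in the real
  arrays 0 and 1; the product is to be stored in the real array 2. All other cells are 0.
\<close>

definition matrix_input :: "nat \<Rightarrow> real mat \<Rightarrow> real mat \<Rightarrow> state" where
  "matrix_input n A B =
     \<lparr>imem = (\<lambda>a i. if a = 0 \<and> i = 0 then int n else 0),
      rmem = (\<lambda>a i.
        if 0 \<le> i \<and> i < int (n * n) then
          (if a = 0 then A $$ (nat i div n, nat i mod n)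
           else if a = 1 then B $$ (nat i div n, nat i mod n) else 0)
        else 0)\<rparr>"

definition matrix_output :: "nat \<Rightarrow> real mat \<Rightarrow> state \<Rightarrow> bool" where
  "matrix_output n C s \<longleftrightarrow> (\<forall>i<n. \<forall>j<n. rmem s 2 (int (i * n + j)) = C $$ (i, j))"

text \<open>
  \<open>n \<times> n\<close> matrices can be multiplied in \<open>O(n\<^sup>\<omega>)\<close> arithmetic operations. This is the defining
  property of the exponent. It is not required that \<open>\<omega>\<close> be the least such number, because
  the infimum of these numbers need not have the property.
\<close>

definition matrix_mult_exponent :: "real \<Rightarrow> bool" where
  "matrix_mult_exponent \<omega> \<longleftrightarrow>
     (\<exists>P. arithmetic P \<and>
        (\<forall>n. \<forall>A \<in> carrier_mat n n. \<forall>B \<in> carrier_mat n n.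
           always_yields P (matrix_input n A B) (matrix_output n (A * B))) \<and>
        runs_in_expected_time P
          (\<lambda>n. {matrix_input n A B | A B. A \<in> carrier_mat n n \<and> B \<in> carrier_mat n n})
          (\<lambda>n. real n powr \<omega>))"


section \<open>Maximum vertex-weighted triangles\<close>

text \<open>
  A simple graph on the vertices \<open>0, \<dots>, n - 1\<close>, given by its set of edges.
\<close>

definition simple_graph :: "nat \<Rightarrow> nat set set \<Rightarrow> bool" where
  "simple_graph n E \<longleftrightarrow> E \<subseteq> {{u, v} | u v. u < n \<and> v < n \<and> u \<noteq> v}"

definition triangle :: "nat set set \<Rightarrow> nat set \<Rightarrow> bool" where
  "triangle E T \<longleftrightarrow> card T = 3 \<and> (\<forall>u \<in> T. \<forall>v \<in> T. u \<noteq> v \<longrightarrow> {u, v} \<in> E)"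

definition triangle_weight :: "(nat \<Rightarrow> real) \<Rightarrow> nat set \<Rightarrow> real" where
  "triangle_weight w T = (\<Sum>v \<in> T. w v)"

definition maximum_triangle :: "nat set set \<Rightarrow> (nat \<Rightarrow> real) \<Rightarrow> nat set \<Rightarrow> bool" where
  "maximum_triangle E w T \<longleftrightarrow>
     triangle E T \<and> (\<forall>T'. triangle E T' \<longrightarrow> triangle_weight w T' \<le> triangle_weight w T)"

text \<open>
  Initially cell 0 of word array 0 holds \<open>n\<close>, word array 1 holds the adjacency matrix row by row,
  and real array 0 holds the weights. All other cells are 0.
\<close>

definition graph_input :: "nat \<Rightarrow> nat set set \<Rightarrow> (nat \<Rightarrow> real) \<Rightarrow> state" where
  "graph_input n E w =
     \<lparr>imem = (\<lambda>a i.
        if a = 0 \<and> i = 0 then int n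
        else if a = 1 \<and> 0 \<le> i \<and> i < int (n * n) \<and> {nat i div n, nat i mod n} \<in> E then 1
        else 0),
      rmem = (\<lambda>a i. if a = 0 \<and> 0 \<le> i \<and> i < int n then w (nat i) else 0)\<rparr>"

text \<open>
  Cell 0 of word array 2 tells whether there is a triangle; if so, the vertices of one of
  maximum weight are in cells 1, 2 and 3.
\<close>

definition maximum_triangle_output :: "nat set set \<Rightarrow> (nat \<Rightarrow> real) \<Rightarrow> state \<Rightarrow> bool" where
  "maximum_triangle_output E w s \<longleftrightarrow>
     (if \<exists>T. triangle E T then
        imem s 2 0 = 1 \<and>
        (\<exists>u v x. imem s 2 1 = int u \<and> imem s 2 2 = int v \<and> imem s 2 3 = int x \<and>
           maximum_triangle E w {u, v, x})
      else imem s 2 0 = 0)"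

end

theory Submission
  imports Defs "HOL-Number_Theory.Cong" "HOL-Real_Asymp.Real_Asymp"
begin

text \<open>
  A deterministic algorithm suffices. Sort the vertices by weight and cut the sorted list into
  \<open>s \<approx> \<surd>n\<close> groups of \<open>s\<close> vertices. For two blocks of \<open>s\<close> vertices each and a group, one product of two
  \<open>s \<times> s\<close> zero-one matrices tells which pairs of vertices of the blocks have a common neighbour in
  the group; the \<open>s\<^sup>3\<close> products take time \<open>O(s\<^sup>3 s\<^sup>\<omega>) = O(n powr ((\<omega> + 3) / 2))\<close>. For every edge, the
  heaviest common neighbour of its ends lies in the last group that contains one, and is found by
  scanning this group, in time \<open>O(n\<^sup>2 s)\<close> altogether. Since a product has \<open>n\<^sup>2\<close> entries to be written,
  \<open>\<omega> \<ge> 2\<close>, and this term is dominated by the first.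

  The given matrix multiplication program computes with rational constants, which the
  comparison/addition model lacks. On integer matrices it is simulated on words modulo a number
  \<open>m = D * s + 1\<close>, where \<open>D\<close> is a common denominator of the constants. As \<open>D\<close> is invertible modulo
  \<open>m\<close> and the entries of the product are at most \<open>s < m\<close>, the residues determine the product.
\<close>

section \<open>Cost semantics of deterministic programs\<close>

text \<open>The multiplication program \<open>M\<close> is a black box, known to be correct only on
  zeroed memory, and it leaves an unknown set of cells behind; yet it is called s^3 times. Each call
  therefore works in its own residue class of addresses modulo \<open>K\<close> = s^3, which no
  earlier call has touched. Large addresses do no harm, since only stored words are bounded. The
  rational intermediate values of \<open>M\<close> may need far more bits than a word has. Their
  denominators divide powers of \<open>D\<close>, so they make sense modulo every number coprime to
  \<open>D\<close>. The choice m = D * s + 1 needs no search, exceeds the entries of the product,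
  fits into a word, and comes with the inverse -s of \<open>D\<close>. Arithmetic programs do not
  test their real data, so replacing reals by residues leaves the flow of control unchanged. With
  groups of size g the products cost (n/g)^3 g^omega = n^3 g^(omega - 3); putting g = sqrt n gives
  the exponent of the theorem.\<close>

primrec deterministic :: "com \<Rightarrow> bool" where
  "deterministic Skip = True"
| "deterministic (IWrite a i e) = True"
| "deterministic (RWrite a i e) = True"
| "deterministic (IRand a i e) = False"
| "deterministic (Seq c d) = (deterministic c \<and> deterministic d)"
| "deterministic (Cond b c d) = (deterministic c \<and> deterministic d)"
| "deterministic (While b c) = deterministic c"

text \<open>The value for \<open>IRand\<close> is a placeholder; the function is compared with
  \<open>step\<close> only on programs without random choices.\<close>

primrec det_step :: "com \<Rightarrow> state \<Rightarrow> com \<times> state" where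
  "det_step Skip s = (Skip, s)"
| "det_step (IWrite a i e) s = (Skip, iwrite a (ival i s) (ival e s) s)"
| "det_step (RWrite a i e) s = (Skip, rwrite a (ival i s) (rval e s) s)"
| "det_step (IRand a i e) s = (Skip, s)"
| "det_step (Seq c d) s =
     (if c = Skip then (d, s) else (Seq (fst (det_step c s)) d, snd (det_step c s)))"
| "det_step (Cond b c d) s = (if bval b s then c else d, s)"
| "det_step (While b c) s = (if bval b s then Seq c (While b c) else Skip, s)"

definition config_step :: "com \<times> state \<Rightarrow> com \<times> state" where
  "config_step cs = det_step (fst cs) (snd cs)"

lemma step_deterministic:
  "deterministic c \<Longrightarrow> step c s = return_pmf (det_step c s)"
  by (induction c arbitrary: s) (auto simp: map_return_pmf case_prod_beta)

lemma deterministic_det_step: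
  "deterministic c \<Longrightarrow> deterministic (fst (det_step c s))"
  by (induction c arbitrary: s) auto

lemma run_deterministic:
  "deterministic (fst cs) \<Longrightarrow> run t cs = return_pmf ((config_step ^^ t) cs)"
proof (induction t arbitrary: cs)
  case (Suc t)
  then show ?case
    using Suc.IH[of "config_step cs"] deterministic_det_step[of "fst cs" "snd cs"]
    by (simp add: step_deterministic bind_return_pmf config_step_def funpow_Suc_right del: funpow.simps)
qed simp

lemma reachable_deterministic:
  "deterministic P \<Longrightarrow> reachable P s = (\<Union>t. {(config_step ^^ t) (P, s)})"
  unfolding reachable_def by (subst run_deterministic) auto

lemma config_step_Skip [simp]: "(config_step ^^ t) (Skip, s) = (Skip, s)"
  by (induction t) (auto simp: config_step_def)

text \<open>A big-step semantics that counts small steps exactly: the 1 in \<open>exec_Seq\<close>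
  discards a finished \<open>Skip\<close>, and the 2 in \<open>exec_While_True\<close> is the test
  plus the discarded \<open>Skip\<close> of the unfolded loop. Since \<open>B\<close> bounds every
  word that is written, a derivation also certifies the word bound.\<close>

inductive exec :: "int \<Rightarrow> com \<Rightarrow> state \<Rightarrow> nat \<Rightarrow> state \<Rightarrow> bool" for B where
  exec_Skip: "exec B Skip s 0 s"
| exec_IWrite: "\<bar>ival e s\<bar> \<le> B \<Longrightarrow> exec B (IWrite a i e) s 1 (iwrite a (ival i s) (ival e s) s)"
| exec_RWrite: "exec B (RWrite a i e) s 1 (rwrite a (ival i s) (rval e s) s)"
| exec_Seq: "exec B c s t s' \<Longrightarrow> exec B d s' u s'' \<Longrightarrow> exec B (Seq c d) s (t + 1 + u) s''"
| exec_Cond: "exec B (if bval b s then c else d) s t s' \<Longrightarrow> exec B (Cond b c d) s (t + 1) s'"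
| exec_While_False: "\<not> bval b s \<Longrightarrow> exec B (While b c) s 1 s"
| exec_While_True: "bval b s \<Longrightarrow> exec B c s t s' \<Longrightarrow> exec B (While b c) s' u s'' \<Longrightarrow>
    exec B (While b c) s (t + u + 2) s''"

inductive_cases exec_SkipE: "exec B Skip s t s'"
inductive_cases exec_SeqE: "exec B (Seq c d) s t s'"

definition words_le :: "int \<Rightarrow> state \<Rightarrow> bool" where
  "words_le B s \<longleftrightarrow> (\<forall>a i. \<bar>imem s a i\<bar> \<le> B)"

lemma imem_iwrite [simp]:
  "imem (iwrite a i v s) = (imem s)(a := (imem s a)(i := v))"
  by (simp add: iwrite_def)

lemma rmem_iwrite [simp]: "rmem (iwrite a i v s) = rmem s"
  by (simp add: iwrite_def)

lemma rmem_rwrite [simp]: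
  "rmem (rwrite a i v s) = (rmem s)(a := (rmem s a)(i := v))"
  by (simp add: rwrite_def)

lemma imem_rwrite [simp]: "imem (rwrite a i v s) = imem s"
  by (simp add: rwrite_def)

text \<open>In the case of a write, the bound that \<open>exec\<close> demands is read off from the
  written cell of the successor state, which is why \<open>words_le\<close> is assumed of
  s'.\<close>

lemma exec_head_step:
  assumes "det_step c s = (c', s')" "c \<noteq> Skip" "deterministic c" "exec B c' s' t s''" "words_le B s'"
  shows "exec B c s (Suc t) s''"
  using assms
proof (induction c arbitrary: c' s' t s'')
  case (IWrite a i e)
  have "\<bar>imem s' a (ival i s)\<bar> \<le> B" using IWrite by (simp add: words_le_def)
  then have "\<bar>ival e s\<bar> \<le> B" using IWrite by auto
  then show ?case using IWrite exec_IWrite[of e s B a i] by (auto elim!: exec_SkipE)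
next
  case (RWrite a i e)
  then show ?case using exec_RWrite[of B a i e s] by (auto elim!: exec_SkipE)
next
  case (Seq c d)
  show ?case
  proof (cases "c = Skip")
    case True
    then show ?thesis using Seq.prems exec_Seq[OF exec_Skip, of B d s t s''] by simp
  next
    case False
    define p where "p = det_step c s"
    have c': "c' = Seq (fst p) d" "s' = snd p" using Seq.prems False by (auto simp: p_def)
    from Seq.prems(4) c' obtain t1 t2 s1 where
      1: "exec B (fst p) s' t1 s1" "exec B d s1 t2 s''" "t = t1 + 1 + t2"
      by (auto elim!: exec_SeqE)
    have "exec B c s (Suc t1) s1"
      using Seq.IH(1)[of "fst p" s' t1 s1] 1 Seq.prems c' False by (auto simp: p_def)
    from exec_Seq[OF this 1(2)] show ?thesis using 1 by simp
  qed
next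
  case (Cond b c d)
  then show ?case using exec_Cond[of B b s c d t s''] by auto
next
  case (While b c)
  show ?case
  proof (cases "bval b s")
    case True
    then have "exec B (Seq c (While b c)) s t s''" using While.prems by auto
    then obtain t1 t2 s1 where "exec B c s t1 s1" "exec B (While b c) s1 t2 s''" "t = t1 + 1 + t2"
      by (auto elim!: exec_SeqE)
    then show ?thesis using exec_While_True[OF True, of B c t1 s1 t2 s''] by simp
  next
    case False
    then show ?thesis using While.prems exec_While_False[of b s B c] by (auto elim!: exec_SkipE)
  qed
qed auto

text \<open>If c' is \<open>Skip\<close>, the second conjunct makes t the exact halting time. The
  third is conditional because \<open>exec\<close> bounds only the words written, not those
  initially in memory.\<close>

definition traced :: "int \<Rightarrow> com \<Rightarrow> state \<Rightarrow> nat \<Rightarrow> com \<Rightarrow> state \<Rightarrow> bool" where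
  "traced B c s t c' s' \<longleftrightarrow> (config_step ^^ t) (c, s) = (c', s') \<and>
     (\<forall>u<t. fst ((config_step ^^ u) (c, s)) \<noteq> Skip) \<and>
     (words_le B s \<longrightarrow> (\<forall>u\<le>t. words_le B (snd ((config_step ^^ u) (c, s)))))"

lemma traced_0: "traced B c s 0 c s"
  by (simp add: traced_def)

lemma traced_trans:
  assumes "traced B c s t c' s'" "traced B c' s' u c'' s''"
  shows "traced B c s (t + u) c'' s''"
proof -
  have eq: "(config_step ^^ (t + v)) (c, s) = (config_step ^^ v) (c', s')" for v
    using assms by (simp add: traced_def funpow_add add.commute[of t])
  have end': "(config_step ^^ (t + u)) (c, s) = (c'', s'')"
    using assms eq by (simp add: traced_def)
  have "fst ((config_step ^^ v) (c, s)) \<noteq> Skip" if "v < t + u" for v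
  proof (cases "v < t")
    case False
    then show ?thesis using assms(2) eq[of "v - t"] that by (auto simp: traced_def)
  qed (use assms in \<open>auto simp: traced_def\<close>)
  moreover have "words_le B (snd ((config_step ^^ v) (c, s)))" if "v \<le> t + u" "words_le B s" for v
  proof (cases "v \<le> t")
    case False
    have "words_le B s'" using assms(1) that by (auto simp: traced_def)
    then show ?thesis using assms(2) eq[of "v - t"] that False by (auto simp: traced_def)
  qed (use assms that in \<open>auto simp: traced_def\<close>)
  ultimately show ?thesis using end' by (simp add: traced_def)
qed

lemma traced_step:
  assumes "det_step c s = (c', s')" "c \<noteq> Skip" "words_le B s \<Longrightarrow> words_le B s'"
  shows "traced B c s 1 c' s'"
  using assms by (auto simp: traced_def config_step_def le_Suc_eq)

text \<open>As long as c has not halted, \<open>Seq c d\<close> copies its steps; the second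
  conjunct of \<open>traced\<close> excludes an earlier halt, at which \<open>Seq\<close> would move
  on to d.\<close>

lemma traced_Seq:
  assumes "traced B c s t c' s'"
  shows "traced B (Seq c d) s t (Seq c' d) s'"
proof -
  have *: "(config_step ^^ u) (Seq c d, s) =
      (Seq (fst ((config_step ^^ u) (c, s))) d, snd ((config_step ^^ u) (c, s)))" if "u \<le> t" for u
    using that
  proof (induction u)
    case (Suc u)
    then have "fst ((config_step ^^ u) (c, s)) \<noteq> Skip" using assms by (auto simp: traced_def)
    then have "det_step (Seq (fst ((config_step ^^ u) (c, s))) d) (snd ((config_step ^^ u) (c, s))) =
        (Seq (fst (config_step ((config_step ^^ u) (c, s)))) d, snd (config_step ((config_step ^^ u) (c, s))))"
      by (simp add: config_step_def)
    then show ?case using Suc by (simp add: config_step_def[of "(Seq _ _, _)"])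
  qed simp
  then show ?thesis using assms by (auto simp: traced_def)
qed

lemma words_le_iwrite: "words_le B s \<Longrightarrow> \<bar>v\<bar> \<le> B \<Longrightarrow> words_le B (iwrite a i v s)"
  by (simp add: words_le_def)

lemma exec_traced: "exec B c s t s' \<Longrightarrow> traced B c s t Skip s'"
proof (induction rule: exec.induct)
  case (exec_Skip s)
  show ?case by (rule traced_0)
next
  case (exec_IWrite e s a i)
  then show ?case by (intro traced_step) (auto intro: words_le_iwrite)
next
  case (exec_RWrite a i e s)
  show ?case by (intro traced_step) (auto simp: words_le_def)
next
  case (exec_Seq c s t s' d u s'')
  have "traced B (Seq Skip d) s' 1 d s'" by (intro traced_step) auto
  from traced_trans[OF traced_trans[OF traced_Seq[OF exec_Seq.IH(1)] this] exec_Seq.IH(2)]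
  show ?case .
next
  case (exec_Cond b s c d t s')
  have "traced B (Cond b c d) s 1 (if bval b s then c else d) s" by (intro traced_step) auto
  from traced_trans[OF this exec_Cond.IH] show ?case by simp
next
  case (exec_While_False b s c)
  then show ?case by (intro traced_step) auto
next
  case (exec_While_True b s c t s' u s'')
  have 1: "traced B (While b c) s 1 (Seq c (While b c)) s"
    using exec_While_True by (intro traced_step) auto
  have 2: "traced B (Seq Skip (While b c)) s' 1 (While b c) s'" by (intro traced_step) auto
  from traced_trans[OF 1 traced_trans[OF traced_Seq[OF exec_While_True.IH(1)]
    traced_trans[OF 2 exec_While_True.IH(2)]]]
  show ?case by (simp add: ac_simps)
qed

lemma expected_time_deterministic:
  assumes "deterministic P"
  shows "expected_time P s =
    (\<Sum>t. if fst ((config_step ^^ t) (P, s)) \<noteq> Skip then 1 else (0::ennreal))"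
  unfolding expected_time_def
  by (subst run_deterministic) (use assms in \<open>auto intro!: suminf_cong simp: indicator_def\<close>)

lemma exec_imp_time:
  assumes "deterministic P" "exec B P s t s'"
  shows "expected_time P s = of_nat t"
proof -
  have tr: "traced B P s t Skip s'" by (rule exec_traced) fact
  have "fst ((config_step ^^ u) (P, s)) = Skip" if "u \<ge> t" for u
  proof -
    have "(config_step ^^ u) (P, s) = (config_step ^^ (u - t)) ((config_step ^^ t) (P, s))"
      using that by (metis funpow_add le_add_diff_inverse2 o_apply)
    then show ?thesis using tr by (simp add: traced_def)
  qed
  then have *: "(fst ((config_step ^^ u) (P, s)) \<noteq> Skip) = (u < t)" for u
    using tr by (cases "u < t") (auto simp: traced_def)
  have "expected_time P s = (\<Sum>u. if u < t then 1 else 0)"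
    unfolding expected_time_deterministic[OF assms(1)] * ..
  also have "\<dots> = (\<Sum>u<t. if u < t then 1 else 0)"
    by (rule suminf_finite) auto
  finally show ?thesis by simp
qed

text \<open>There is only one computation: before time t it has not halted, and from t on it rests
  at \<open>(Skip, s')\<close>.\<close>

lemma exec_imp_reachable:
  assumes "deterministic P" "exec B P s t s'" "(c, s1) \<in> reachable P s"
  shows "c = Skip \<Longrightarrow> s1 = s'" "words_le B s \<Longrightarrow> words_le B s1"
proof -
  have tr: "traced B P s t Skip s'" by (rule exec_traced) fact
  from assms obtain u where u: "(config_step ^^ u) (P, s) = (c, s1)"
    by (auto simp: reachable_deterministic)
  have late: "(c, s1) = (Skip, s')" if "t \<le> u"
  proof -
    have "(config_step ^^ u) (P, s) = (config_step ^^ (u - t)) ((config_step ^^ t) (P, s))"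
      using that by (metis funpow_add le_add_diff_inverse2 o_apply)
    then show ?thesis using tr u by (simp add: traced_def)
  qed
  show "s1 = s'" if "c = Skip"
  proof (cases "t \<le> u")
    case False
    then have "fst ((config_step ^^ u) (P, s)) \<noteq> Skip" using tr by (simp add: traced_def)
    then show ?thesis using u that by simp
  qed (use late in simp)
  show "words_le B s1" if "words_le B s"
  proof (cases "t \<le> u")
    case True
    then show ?thesis using late tr that by (auto simp: traced_def)
  next
    case False
    then have "words_le B (snd ((config_step ^^ u) (P, s)))" using tr that by (simp add: traced_def)
    then show ?thesis using u by simp
  qed
qed

text \<open>The converse of \<open>exec_traced\<close>. The multiplication program is given by its
  small steps; the simulation below needs a derivation to induct on.\<close>

lemma config_steps_imp_exec:
  assumes "(config_step ^^ t) (c, s) = (Skip, s')" "deterministic c"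
    "\<And>u. words_le B (snd ((config_step ^^ u) (c, s)))"
  shows "\<exists>t'. exec B c s t' s'"
  using assms
proof (induction t arbitrary: c s)
  case 0
  then show ?case by (auto intro: exec_Skip)
next
  case (Suc t)
  show ?case
  proof (cases "c = Skip")
    case True
    then show ?thesis using Suc.prems(1) config_step_Skip[of "Suc t" s] by (auto intro: exec_Skip simp del: funpow.simps)
  next
    case False
    obtain c1 s1 where 1: "det_step c s = (c1, s1)" by fastforce
    have eq: "(config_step ^^ u) (c1, s1) = (config_step ^^ Suc u) (c, s)" for u
      by (simp add: funpow_Suc_right config_step_def 1 del: funpow.simps)
    have "\<exists>t'. exec B c1 s1 t' s'"
    proof (rule Suc.IH)
      show "deterministic c1" using deterministic_det_step[OF Suc.prems(2), of s] 1 by simp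
      show "(config_step ^^ t) (c1, s1) = (Skip, s')" unfolding eq by (rule Suc.prems(1))
      show "words_le B (snd ((config_step ^^ u) (c1, s1)))" for u unfolding eq by (rule Suc.prems(3))
    qed
    then obtain t' where "exec B c1 s1 t' s'" ..
    moreover have "words_le B s1" using Suc.prems(3)[of 1] 1 by (simp add: config_step_def)
    ultimately show ?thesis using exec_head_step[OF 1 False Suc.prems(2)] by blast
  qed
qed

text \<open>A deterministic program that never halts contributes 1 for every t, so its expected time
  is infinite.\<close>

lemma finite_time_imp_exec:
  assumes "deterministic P" "expected_time P s < \<infinity>" "words_bounded B P s"
  obtains t s' where "exec B P s t s'"
proof -
  have "\<exists>t. fst ((config_step ^^ t) (P, s)) = Skip"
  proof (rule ccontr)
    assume "\<not> ?thesis"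
    then have "expected_time P s = (\<Sum>t. 1)"
      unfolding expected_time_deterministic[OF assms(1)] by (intro suminf_cong) auto
    also have "\<dots> = \<top>"
    proof (rule ccontr)
      assume "(\<Sum>t::nat. 1::ennreal) \<noteq> \<top>"
      then obtain k :: nat where k: "(\<Sum>t::nat. 1::ennreal) < of_nat k"
        using ennreal_Ex_less_of_nat by (auto simp: less_top)
      have "(\<Sum>t<k. 1::ennreal) \<le> (\<Sum>t. 1)" by (rule sum_le_suminf) auto
      then show False using k by simp
    qed
    finally show False using assms(2) by simp
  qed
  then obtain t s' where t: "(config_step ^^ t) (P, s) = (Skip, s')" by (metis prod.collapse)
  have "words_le B (snd ((config_step ^^ u) (P, s)))" for u
  proof -
    have "(config_step ^^ u) (P, s) \<in> reachable P s" using assms(1) by (auto simp: reachable_deterministic)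
    then show ?thesis using assms(3) by (auto simp: words_bounded_def words_le_def case_prod_beta)
  qed
  from config_steps_imp_exec[OF t assms(1) this] show ?thesis using that by blast
qed

lemma exec_reachable:
  assumes "deterministic P" "exec B P s t s'"
  shows "(Skip, s') \<in> reachable P s"
  using exec_traced[OF assms(2)] assms(1) by (auto simp: reachable_deterministic traced_def intro: exI[of _ t])

lemma arithmetic_deterministic: "arithmetic c \<Longrightarrow> deterministic c"
  by (induction c) auto

section \<open>Simulating arithmetic programs modulo an integer\<close>

text \<open>
  \<open>v\<close> represents the rational number \<open>x\<close>, whose denominator divides a power of \<open>D\<close>, modulo \<open>m\<close>.
\<close>

definition residue :: "int \<Rightarrow> int \<Rightarrow> real \<Rightarrow> int \<Rightarrow> bool" where
  "residue D m x v \<longleftrightarrow> 0 \<le> v \<and> v < m \<and>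
     (\<exists>e p. x * of_int D ^ e = of_int p \<and> [D ^ e * v = p] (mod m))"

lemma residueI:
  assumes "m > 0" "x * of_int D ^ e = of_int p" "[D ^ e * v = p] (mod m)"
  shows "residue D m x (v mod m)"
proof -
  have "[D ^ e * (v mod m) = p] (mod m)" using assms(3) by (simp add: cong_def mod_mult_right_eq)
  then show ?thesis using assms unfolding residue_def by auto
qed

lemma residue_of_int: "0 \<le> k \<Longrightarrow> k < m \<Longrightarrow> residue D m (of_int k) k"
  unfolding residue_def by (auto intro!: exI[of _ 0] exI[of _ k])

lemma residueE:
  assumes "residue D m x v"
  obtains e p where "m > 0" "x * of_int D ^ e = of_int p" "[D ^ e * v = p] (mod m)"
  using assms unfolding residue_def by auto

text \<open>Bringing two fractions with denominators \<open>D ^ e\<close> and \<open>D ^ f\<close>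
  to the denominator \<open>D ^ (e + f)\<close>.\<close>

lemma residue_common_exponent:
  assumes "residue D m x v" "residue D m y w"
  obtains e p q where "m > 0" "x * of_int D ^ e = of_int p" "[D ^ e * v = p] (mod m)"
    "y * of_int D ^ e = of_int q" "[D ^ e * w = q] (mod m)"
proof -
  from assms(1) obtain e p where 1: "m > 0" "x * of_int D ^ e = of_int p" "[D ^ e * v = p] (mod m)"
    by (rule residueE)
  from assms(2) obtain f q where 2: "y * of_int D ^ f = of_int q" "[D ^ f * w = q] (mod m)"
    by (rule residueE)
  show ?thesis
  proof (rule that[of "e + f" "p * D ^ f" "q * D ^ e"])
    show "x * of_int D ^ (e + f) = of_int (p * D ^ f)" using 1 by (simp add: power_add)
    show "y * of_int D ^ (e + f) = of_int (q * D ^ e)" using 2 by (simp add: power_add mult_ac)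
    show "[D ^ (e + f) * v = p * D ^ f] (mod m)"
      using cong_scalar_right[OF 1(3), of "D ^ f"] by (simp add: power_add mult_ac)
    show "[D ^ (e + f) * w = q * D ^ e] (mod m)"
      using cong_scalar_right[OF 2(2), of "D ^ e"] by (simp add: power_add mult_ac)
  qed fact
qed

lemma residue_add:
  assumes "residue D m x v" "residue D m y w"
  shows "residue D m (x + y) ((v + w) mod m)"
proof -
  obtain e p q where *: "m > 0" "x * of_int D ^ e = of_int p" "[D ^ e * v = p] (mod m)"
    "y * of_int D ^ e = of_int q" "[D ^ e * w = q] (mod m)"
    using assms by (rule residue_common_exponent)
  show ?thesis
  proof (rule residueI)
    show "(x + y) * of_int D ^ e = of_int (p + q)" using * by (simp add: algebra_simps)
    show "[D ^ e * (v + w) = p + q] (mod m)" using cong_add[OF *(3,5)] by (simp add: algebra_simps)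
  qed fact
qed

lemma residue_diff:
  assumes "residue D m x v" "residue D m y w"
  shows "residue D m (x - y) ((v - w) mod m)"
proof -
  obtain e p q where *: "m > 0" "x * of_int D ^ e = of_int p" "[D ^ e * v = p] (mod m)"
    "y * of_int D ^ e = of_int q" "[D ^ e * w = q] (mod m)"
    using assms by (rule residue_common_exponent)
  show ?thesis
  proof (rule residueI)
    show "(x - y) * of_int D ^ e = of_int (p - q)" using * by (simp add: algebra_simps)
    show "[D ^ e * (v - w) = p - q] (mod m)" using cong_diff[OF *(3,5)] by (simp add: algebra_simps)
  qed fact
qed

lemma residue_mult:
  assumes "residue D m x v" "residue D m y w"
  shows "residue D m (x * y) ((v * w) mod m)"
proof -
  obtain e p q where *: "m > 0" "x * of_int D ^ e = of_int p" "[D ^ e * v = p] (mod m)"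
    "y * of_int D ^ e = of_int q" "[D ^ e * w = q] (mod m)"
    using assms by (rule residue_common_exponent)
  show ?thesis
  proof (rule residueI)
    have "(x * of_int D ^ e) * (y * of_int D ^ e) = of_int p * of_int q" using * by simp
    then show "(x * y) * of_int D ^ (e + e) = of_int (p * q)" by (simp add: power_add mult_ac)
    show "[D ^ (e + e) * (v * w) = p * q] (mod m)"
      using cong_mult[OF *(3,5)] by (simp add: power_add mult_ac)
  qed fact
qed

text \<open>Since \<open>D * s\<close> is \<open>-1\<close> modulo \<open>m\<close>, division by \<open>D\<close> is multiplication by \<open>-s\<close>.\<close>

lemma residue_const:
  assumes "m = D * s + 1" "m > 0" "q * of_int D \<in> \<int>"
  shows "residue D m (of_rat q) ((- \<lfloor>q * of_int D\<rfloor> * s) mod m)"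
proof (rule residueI)
  have "of_int \<lfloor>q * of_int D\<rfloor> = q * of_int D"
    using assms(3) by (cases rule: Ints_cases) simp
  then have "real_of_rat (of_int \<lfloor>q * of_int D\<rfloor>) = of_rat (q * of_int D)"
    by (simp only:)
  then show "of_rat q * of_int D ^ 1 = real_of_int \<lfloor>q * of_int D\<rfloor>" by (simp add: of_rat_mult)
  have "D ^ 1 * (- \<lfloor>q * of_int D\<rfloor> * s) = \<lfloor>q * of_int D\<rfloor> + m * (- \<lfloor>q * of_int D\<rfloor>)"
    by (simp add: assms(1) algebra_simps)
  then show "[D ^ 1 * (- \<lfloor>q * of_int D\<rfloor> * s) = \<lfloor>q * of_int D\<rfloor>] (mod m)"
    by (simp only: cong_def mod_mult_self2)
qed (fact assms(2))

text \<open>\<open>residue\<close> fixes v only after multiplication by an unknown power of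
  \<open>D\<close>. This power cancels, because a common divisor of \<open>D\<close> and m divides m
  - D * s = 1.\<close>

lemma residue_unique:
  assumes "residue D m (of_int k) v" "m = D * s + 1" "0 \<le> k" "k < m"
  shows "v = k"
proof -
  obtain e p where *: "of_int k * of_int D ^ e = real_of_int p" "[D ^ e * v = p] (mod m)"
    using assms(1) by (rule residueE)
  have "real_of_int (k * D ^ e) = real_of_int p" using *(1) by simp
  then have "p = D ^ e * k" by (simp only: of_int_eq_iff) (simp add: mult.commute)
  moreover have "coprime D m"
  proof (rule coprimeI)
    fix c assume "c dvd D" "c dvd m"
    then have "c dvd m - D * s" by (intro dvd_diff) auto
    then show "is_unit c" using assms(2) by simp
  qed
  then have "coprime (D ^ e) m" by simp
  ultimately have "[v = k] (mod m)" using *(2) by (simp add: cong_mult_lcancel)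
  then show ?thesis using assms by (simp add: residue_def cong_def)
qed

text \<open>\<open>D\<close> is a common denominator of the rational constants of a program.\<close>

primrec clears_rexp :: "int \<Rightarrow> rexp \<Rightarrow> bool" where
  "clears_rexp D (RConst q) = (q * of_int D \<in> \<int>)"
| "clears_rexp D (RRead a i) = True"
| "clears_rexp D (RAdd e f) = (clears_rexp D e \<and> clears_rexp D f)"
| "clears_rexp D (RSub e f) = (clears_rexp D e \<and> clears_rexp D f)"
| "clears_rexp D (RMul e f) = (clears_rexp D e \<and> clears_rexp D f)"

primrec clears :: "int \<Rightarrow> com \<Rightarrow> bool" where
  "clears D Skip = True"
| "clears D (IWrite a i e) = True"
| "clears D (RWrite a i e) = clears_rexp D e"
| "clears D (IRand a i e) = True"
| "clears D (Seq c d) = (clears D c \<and> clears D d)"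
| "clears D (Cond b c d) = (clears D c \<and> clears D d)"
| "clears D (While b c) = clears D c"

lemma clears_rexp_mult: "clears_rexp D e \<Longrightarrow> clears_rexp (D * E) e \<and> clears_rexp (E * D) e"
proof (induction e)
  case (RConst q)
  then have "q * of_int D * of_int E \<in> \<int>" by (auto intro!: Ints_mult)
  then show ?case by (auto simp: mult_ac)
qed auto

lemma clears_mult: "clears D c \<Longrightarrow> clears (D * E) c \<and> clears (E * D) c"
  by (induction c) (auto simp: clears_rexp_mult)

text \<open>The induction step of the next two lemmas: the product of denominators for two subterms
  serves both.\<close>

lemma ex_pos_mult:
  assumes "\<exists>D::int>0. P D" "\<exists>E>0. Q E"
    and "\<And>D E. P D \<Longrightarrow> P (D * E)" "\<And>D E. Q E \<Longrightarrow> Q (D * E)"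
  shows "\<exists>D>0. P D \<and> Q D"
  using assms by (meson mult_pos_pos)

lemma ex_clears_rexp: "\<exists>D>0. clears_rexp D e"
proof (induction e)
  case (RConst q)
  obtain a b where ab: "quotient_of q = (a, b)" by fastforce
  have "b > 0" using quotient_of_denom_pos[OF ab] .
  moreover have "q * of_int b = of_int a" using quotient_of_div[OF ab] \<open>b > 0\<close> by simp
  ultimately show ?case by (auto intro!: exI[of _ b])
qed (auto intro: ex_pos_mult exI[of _ 1] simp: clears_rexp_mult)

lemma ex_clears: "\<exists>D>0. clears D c"
proof (induction c)
  case (RWrite a i e)
  then show ?case using ex_clears_rexp[of e] by simp
qed (auto intro: ex_pos_mult exI[of _ 1] simp: clears_mult)

definition scalar :: "int \<Rightarrow> iexp" where
  "scalar c = IRead 3 (IConst c)"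

lemma ival_scalar [simp]: "ival (scalar c) s = imem s 3 c"
  by (simp add: scalar_def)

text \<open>
  Scalar 0 holds the dimension \<open>s\<close> of the matrices, scalar 1 the modulus \<open>m\<close>, and scalars 2 and 3
  the number \<open>K\<close> of simulated runs and the number \<open>x\<close> of the current one. Run \<open>x\<close> keeps its cell \<open>i\<close>
  in cell \<open>i * K + x\<close>, so that every run starts with fresh memory.
\<close>

definition cell_of_run :: "iexp \<Rightarrow> iexp" where
  "cell_of_run i = IAdd (IMul i (scalar 2)) (scalar 3)"

text \<open>Word array a becomes array \<open>2 * a + 8\<close> and real array a becomes word array
  \<open>2 * a + 9\<close>, so arrays below 8 stay with the surrounding program. In particular the
  dimension goes to array 8, the factors to 9 and 11, and the product appears in 13.\<close>

primrec sim_iexp :: "iexp \<Rightarrow> iexp" where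
  "sim_iexp (IConst k) = IConst k"
| "sim_iexp (IRead a i) = IRead (2 * a + 8) (cell_of_run (sim_iexp i))"
| "sim_iexp (IAdd e f) = IAdd (sim_iexp e) (sim_iexp f)"
| "sim_iexp (ISub e f) = ISub (sim_iexp e) (sim_iexp f)"
| "sim_iexp (IMul e f) = IMul (sim_iexp e) (sim_iexp f)"
| "sim_iexp (IDiv e f) = IDiv (sim_iexp e) (sim_iexp f)"
| "sim_iexp (IMod e f) = IMod (sim_iexp e) (sim_iexp f)"

primrec sim_rexp :: "int \<Rightarrow> rexp \<Rightarrow> iexp" where
  "sim_rexp D (RConst q) = IMod (IMul (IConst (- \<lfloor>q * of_int D\<rfloor>)) (scalar 0)) (scalar 1)"
| "sim_rexp D (RRead a i) = IRead (2 * a + 9) (cell_of_run (sim_iexp i))"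
| "sim_rexp D (RAdd e f) = IMod (IAdd (sim_rexp D e) (sim_rexp D f)) (scalar 1)"
| "sim_rexp D (RSub e f) = IMod (ISub (sim_rexp D e) (sim_rexp D f)) (scalar 1)"
| "sim_rexp D (RMul e f) = IMod (IMul (sim_rexp D e) (sim_rexp D f)) (scalar 1)"

text \<open>Tests of real numbers and random choices do not occur in arithmetic programs.\<close>

primrec sim_bexp :: "bexp \<Rightarrow> bexp" where
  "sim_bexp (ILe e f) = ILe (sim_iexp e) (sim_iexp f)"
| "sim_bexp (RLe e f) = ILe (IConst 0) (IConst 0)"
| "sim_bexp (BNot b) = BNot (sim_bexp b)"
| "sim_bexp (BAnd b c) = BAnd (sim_bexp b) (sim_bexp c)"

primrec sim_com :: "int \<Rightarrow> com \<Rightarrow> com" where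
  "sim_com D Skip = Skip"
| "sim_com D (IWrite a i e) = IWrite (2 * a + 8) (cell_of_run (sim_iexp i)) (sim_iexp e)"
| "sim_com D (RWrite a i e) = IWrite (2 * a + 9) (cell_of_run (sim_iexp i)) (sim_rexp D e)"
| "sim_com D (IRand a i e) = Skip"
| "sim_com D (Seq c d) = Seq (sim_com D c) (sim_com D d)"
| "sim_com D (Cond b c d) = Cond (sim_bexp b) (sim_com D c) (sim_com D d)"
| "sim_com D (While b c) = While (sim_bexp b) (sim_com D c)"

lemma deterministic_sim_com: "deterministic (sim_com D c)"
  by (induction c) auto

lemma addition_bexp_sim_bexp: "addition_bexp (sim_bexp b)"
  by (induction b) auto

lemma comparison_addition_sim_com: "comparison_addition (sim_com D c)"
  by (induction c) (auto simp: addition_bexp_sim_bexp)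

section \<open>The simulation invariant\<close>

locale simulation =
  fixes D m s K x :: int and init :: state
  assumes modulus: "m = D * s + 1" "m > 0"
    and run_number: "0 \<le> x" "x < K"
    and scalars: "imem init 3 0 = s" "imem init 3 1 = m" "imem init 3 2 = K" "imem init 3 3 = x"
begin

text \<open>The last three conjuncts are frame conditions: the arrays of the surrounding program,
  the real memory and the cells of all other runs stay as they were in \<open>init\<close>.\<close>

definition represents :: "state \<Rightarrow> state \<Rightarrow> bool" where
  "represents \<sigma> \<tau> \<longleftrightarrow>
     (\<forall>a i. imem \<sigma> (2 * a + 8) (i * K + x) = imem \<tau> a i) \<and>
     (\<forall>a i. residue D m (rmem \<tau> a i) (imem \<sigma> (2 * a + 9) (i * K + x))) \<and>
     (\<forall>a<8. imem \<sigma> a = imem init a) \<and> rmem \<sigma> = rmem init \<and>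
     (\<forall>a j. j mod K \<noteq> x \<longrightarrow> imem \<sigma> a j = imem init a j)"

lemma cell_inj: "i * K + x = j * K + x \<longleftrightarrow> i = j"
  using run_number by auto

lemma K_nonzero: "K \<noteq> 0"
  using run_number by auto

lemma cell_mod: "(i * K + x) mod K = x" "x mod K = x"
  using run_number by simp_all

context
  fixes \<sigma> \<tau> :: state
  assumes rep: "represents \<sigma> \<tau>"
begin

lemma represents_scalar: "imem \<sigma> 3 c = imem init 3 c"
  using rep by (simp add: represents_def)

lemma ival_cell_of_run: "ival (cell_of_run i) \<sigma> = ival i \<sigma> * K + x"
  by (simp add: cell_of_run_def represents_scalar scalars)

lemma ival_sim_iexp: "ival (sim_iexp e) \<sigma> = ival e \<tau>"
  using rep by (induction e) (auto simp: ival_cell_of_run represents_def)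

lemma residue_sim_rexp: "clears_rexp D e \<Longrightarrow> residue D m (rval e \<tau>) (ival (sim_rexp D e) \<sigma>)"
proof (induction e)
  case (RConst q)
  then show ?case using residue_const[of m D s q] modulus by (simp add: represents_scalar scalars)
next
  case (RRead a i)
  then show ?case using rep by (simp add: ival_cell_of_run ival_sim_iexp represents_def)
qed (simp_all add: represents_scalar scalars residue_add residue_diff residue_mult)

lemma bval_sim_bexp: "data_free b \<Longrightarrow> bval (sim_bexp b) \<sigma> = bval b \<tau>"
  by (induction b) (auto simp: ival_sim_iexp)

lemma represents_iwrite: "represents (iwrite (2 * a + 8) (i * K + x) v \<sigma>) (iwrite a i v \<tau>)"
proof -
  have ne: "2 * b + 9 \<noteq> 2 * a + 8" for b by presburger
  have eq: "2 * b + 8 = 2 * a + 8 \<longleftrightarrow> b = a" for b by presburger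
  show ?thesis
    using rep by (auto simp: represents_def cell_inj cell_mod ne eq K_nonzero)
qed

lemma represents_rwrite:
  assumes "residue D m y v"
  shows "represents (iwrite (2 * a + 9) (i * K + x) v \<sigma>) (rwrite a i y \<tau>)"
proof -
  have ne: "2 * b + 8 \<noteq> 2 * a + 9" for b by presburger
  have eq: "2 * b + 9 = 2 * a + 9 \<longleftrightarrow> b = a" for b by presburger
  show ?thesis
    using rep assms by (auto simp: represents_def cell_inj cell_mod ne eq K_nonzero)
qed

end

text \<open>The time t is preserved because each command is translated into one command and
  data-free tests have the same outcome. The bound B' must exceed m since residues are now stored as
  words.\<close>

lemma exec_sim_com:
  assumes "exec B c \<tau> t \<tau>'" "arithmetic c" "clears D c" "represents \<sigma> \<tau>" "B \<le> B'" "m \<le> B'"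
  shows "\<exists>\<sigma>'. exec B' (sim_com D c) \<sigma> t \<sigma>' \<and> represents \<sigma>' \<tau>'"
  using assms
proof (induction arbitrary: \<sigma> rule: exec.induct)
  case (exec_Skip s)
  then show ?case by (auto intro: exec.exec_Skip)
next
  case (exec_IWrite e s a i)
  then have "exec B' (sim_com D (IWrite a i e)) \<sigma> 1 (iwrite (2 * a + 8) (ival i s * K + x) (ival e s) \<sigma>)"
    using exec.exec_IWrite[of "sim_iexp e" \<sigma> B' "2 * a + 8" "cell_of_run (sim_iexp i)"]
    by (simp add: ival_cell_of_run ival_sim_iexp)
  then show ?case using represents_iwrite[OF exec_IWrite.prems(3)] by blast
next
  case (exec_RWrite a i e s)
  have r: "residue D m (rval e s) (ival (sim_rexp D e) \<sigma>)"
    using exec_RWrite.prems by (intro residue_sim_rexp) auto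
  then have "exec B' (sim_com D (RWrite a i e)) \<sigma> 1
      (iwrite (2 * a + 9) (ival i s * K + x) (ival (sim_rexp D e) \<sigma>) \<sigma>)"
    using exec.exec_IWrite[of "sim_rexp D e" \<sigma> B' "2 * a + 9" "cell_of_run (sim_iexp i)"] exec_RWrite.prems
    by (simp add: ival_cell_of_run[OF exec_RWrite.prems(3)] ival_sim_iexp[OF exec_RWrite.prems(3)] residue_def)
  then show ?case using represents_rwrite[OF exec_RWrite.prems(3) r] by blast
next
  case (exec_Seq c s t s' d u s'')
  then obtain \<sigma>1 where 1: "exec B' (sim_com D c) \<sigma> t \<sigma>1" "represents \<sigma>1 s'" by fastforce
  with exec_Seq obtain \<sigma>2 where "exec B' (sim_com D d) \<sigma>1 u \<sigma>2" "represents \<sigma>2 s''" by fastforce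
  then show ?case using exec.exec_Seq[OF 1(1)] by auto
next
  case (exec_Cond b s c d t s')
  then have b: "bval (sim_bexp b) \<sigma> = bval b s" by (simp add: bval_sim_bexp)
  obtain \<sigma>1 where "exec B' (sim_com D (if bval b s then c else d)) \<sigma> t \<sigma>1" "represents \<sigma>1 s'"
    using exec_Cond.IH[of \<sigma>] exec_Cond.prems by (cases "bval b s") auto
  then show ?case
    using exec.exec_Cond[of B' "sim_bexp b" \<sigma> "sim_com D c" "sim_com D d" t \<sigma>1]
    by (auto simp: b split: if_splits)
next
  case (exec_While_False b s c)
  then have "\<not> bval (sim_bexp b) \<sigma>" by (simp add: bval_sim_bexp)
  from exec.exec_While_False[OF this, of B' "sim_com D c"] show ?case
    using exec_While_False.prems by auto
next
  case (exec_While_True b s c t s' u s'')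
  then have b: "bval (sim_bexp b) \<sigma>" by (simp add: bval_sim_bexp)
  from exec_While_True obtain \<sigma>1 where 1: "exec B' (sim_com D c) \<sigma> t \<sigma>1" "represents \<sigma>1 s'" by fastforce
  with exec_While_True obtain \<sigma>2 where "exec B' (sim_com D (While b c)) \<sigma>1 u \<sigma>2" "represents \<sigma>2 s''"
    by fastforce
  then show ?case using exec.exec_While_True[OF b 1(1)] by auto
qed

end

section \<open>Total correctness with time bounds\<close>

definition achieves :: "int \<Rightarrow> com \<Rightarrow> state \<Rightarrow> nat \<Rightarrow> (state \<Rightarrow> bool) \<Rightarrow> bool" where
  "achieves B c \<sigma> T Q \<longleftrightarrow> (\<exists>t \<sigma>'. exec B c \<sigma> t \<sigma>' \<and> t \<le> T \<and> Q \<sigma>')"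

lemma achieves_weaken:
  assumes "achieves B c \<sigma> T Q" "T \<le> U" "\<And>\<sigma>'. Q \<sigma>' \<Longrightarrow> R \<sigma>'"
  shows "achieves B c \<sigma> U R"
  using assms unfolding achieves_def by (meson le_trans)

lemma achieves_Skip: "Q \<sigma> \<Longrightarrow> achieves B Skip \<sigma> T Q"
  unfolding achieves_def using exec_Skip[of B \<sigma>] by blast

lemma achieves_IWrite:
  assumes "\<bar>ival e \<sigma>\<bar> \<le> B" "1 \<le> T" "Q (iwrite a (ival i \<sigma>) (ival e \<sigma>) \<sigma>)"
  shows "achieves B (IWrite a i e) \<sigma> T Q"
  unfolding achieves_def using exec_IWrite[OF assms(1), of a i] assms by blast

lemma achieves_Seq:
  assumes "achieves B c \<sigma> T Q" "\<And>\<sigma>'. Q \<sigma>' \<Longrightarrow> achieves B d \<sigma>' U R" "T + U + 1 \<le> V"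
  shows "achieves B (Seq c d) \<sigma> V R"
proof -
  obtain t \<sigma>' where 1: "exec B c \<sigma> t \<sigma>'" "t \<le> T" "Q \<sigma>'" using assms(1) unfolding achieves_def by blast
  obtain u \<sigma>'' where 2: "exec B d \<sigma>' u \<sigma>''" "u \<le> U" "R \<sigma>''"
    using assms(2)[OF 1(3)] unfolding achieves_def by blast
  have "t + 1 + u \<le> V" using 1 2 assms(3) by simp
  then show ?thesis unfolding achieves_def using exec_Seq[OF 1(1) 2(1)] 2(3) by blast
qed

lemma achieves_IWrite_Seq:
  assumes "\<bar>ival e \<sigma>\<bar> \<le> B" "achieves B d (iwrite a (ival i \<sigma>) (ival e \<sigma>) \<sigma>) U R" "U + 2 \<le> V"
  shows "achieves B (Seq (IWrite a i e) d) \<sigma> V R"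
  by (rule achieves_Seq[where T = 1 and U = U and Q = "\<lambda>\<sigma>'. \<sigma>' = iwrite a (ival i \<sigma>) (ival e \<sigma>) \<sigma>"])
    (use assms in \<open>auto intro: achieves_IWrite\<close>)

lemma achieves_Cond:
  assumes "bval b \<sigma> \<Longrightarrow> achieves B c \<sigma> T Q" "\<not> bval b \<sigma> \<Longrightarrow> achieves B d \<sigma> T Q" "T + 1 \<le> U"
  shows "achieves B (Cond b c d) \<sigma> U Q"
proof -
  have "achieves B (if bval b \<sigma> then c else d) \<sigma> T Q" using assms by auto
  then obtain t \<sigma>' where 1: "exec B (if bval b \<sigma> then c else d) \<sigma> t \<sigma>'" "t \<le> T" "Q \<sigma>'"
    unfolding achieves_def by blast
  have "t + 1 \<le> U" using 1(2) assms(3) by simp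
  then show ?thesis unfolding achieves_def using exec_Cond[OF 1(1)] 1(3) by blast
qed

definition For :: "int \<Rightarrow> iexp \<Rightarrow> com \<Rightarrow> com" where
  "For v e c = Seq (IWrite 3 (IConst v) (IConst 0))
     (While (BNot (ILe e (scalar v)))
       (Seq c (IWrite 3 (IConst v) (IAdd (scalar v) (IConst 1)))))"

text \<open>A round costs 4 besides the body: the test, the increment and two discarded
  \<open>Skip\<close>s. The 3 outside are the initialisation, its discarded \<open>Skip\<close> and
  the last test. The invariant is required after the increment, so that it may speak about the
  counter.\<close>

lemma achieves_For:
  fixes Inv :: "nat \<Rightarrow> state \<Rightarrow> bool"
  assumes init: "Inv 0 (iwrite 3 v 0 \<sigma>)"
    and inv: "\<And>i \<sigma>. Inv i \<sigma> \<Longrightarrow> imem \<sigma> 3 v = int i \<and> ival e \<sigma> = int N"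
    and body: "\<And>i \<sigma>. i < N \<Longrightarrow> Inv i \<sigma> \<Longrightarrow> achieves B c \<sigma> T
      (\<lambda>\<sigma>'. imem \<sigma>' 3 v = int i \<and> Inv (Suc i) (iwrite 3 v (int (Suc i)) \<sigma>'))"
    and B: "int N \<le> B"
    and U: "N * (T + 4) + 3 \<le> U"
    and post: "\<And>\<sigma>. Inv N \<sigma> \<Longrightarrow> Q \<sigma>"
  shows "achieves B (For v e c) \<sigma> U Q"
proof -
  let ?W = "While (BNot (ILe e (scalar v))) (Seq c (IWrite 3 (IConst v) (IAdd (scalar v) (IConst 1))))"
  have loop: "\<exists>t \<sigma>'. exec B ?W \<sigma> t \<sigma>' \<and> t \<le> k * (T + 4) + 1 \<and> Inv N \<sigma>'"
    if "Inv i \<sigma>" "i + k = N" for i k \<sigma>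
    using that
  proof (induction k arbitrary: i \<sigma>)
    case 0
    then have "\<not> bval (BNot (ILe e (scalar v))) \<sigma>" using inv[of i \<sigma>] by simp
    then have "exec B ?W \<sigma> 1 \<sigma>" by (rule exec_While_False)
    then show ?case using 0 by auto
  next
    case (Suc k)
    then have i: "i < N" by simp
    have b: "bval (BNot (ILe e (scalar v))) \<sigma>" using inv[OF Suc.prems(1)] i by simp
    obtain t \<sigma>1 where 1: "exec B c \<sigma> t \<sigma>1" "t \<le> T" "imem \<sigma>1 3 v = int i"
      "Inv (Suc i) (iwrite 3 v (int (Suc i)) \<sigma>1)"
      using body[OF i Suc.prems(1)] unfolding achieves_def by blast
    have "exec B (IWrite 3 (IConst v) (IAdd (scalar v) (IConst 1))) \<sigma>1 1 (iwrite 3 v (int (Suc i)) \<sigma>1)"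
      using exec_IWrite[of "IAdd (scalar v) (IConst 1)" \<sigma>1 B 3 "IConst v"] 1(3) i B
      by (simp add: add.commute)
    note 2 = exec_Seq[OF 1(1) this]
    obtain u \<sigma>2 where 3: "exec B ?W (iwrite 3 v (int (Suc i)) \<sigma>1) u \<sigma>2" "u \<le> k * (T + 4) + 1" "Inv N \<sigma>2"
      using Suc.IH[OF 1(4)] Suc.prems by auto
    have "t + 1 + 1 + u + 2 \<le> Suc k * (T + 4) + 1" using 1(2) 3(2) by simp
    then show ?case using exec_While_True[OF b 2 3(1)] 3(3) by blast
  qed
  obtain t \<sigma>' where t: "exec B ?W (iwrite 3 v 0 \<sigma>) t \<sigma>'" "t \<le> N * (T + 4) + 1" "Inv N \<sigma>'"
    using loop[OF init, of N] by auto
  have "exec B (IWrite 3 (IConst v) (IConst 0)) \<sigma> 1 (iwrite 3 v 0 \<sigma>)"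
    using exec_IWrite[of "IConst 0" \<sigma> B 3 "IConst v"] B by simp
  note exec_Seq[OF this t(1)]
  moreover have "1 + 1 + t \<le> U" using t(2) U by simp
  ultimately show ?thesis unfolding achieves_def For_def using t(3) post by blast
qed

lemma deterministic_For: "deterministic c \<Longrightarrow> deterministic (For v e c)"
  by (simp add: For_def)

lemma comparison_addition_For: "comparison_addition c \<Longrightarrow> comparison_addition (For v e c)"
  by (simp add: For_def)

section \<open>The program\<close>

text \<open>
  The dimension \<open>s\<close> in scalar 0 is the least number with \<open>n \<le> s\<^sup>2\<close>; the possible ranks \<open>0, \<dots>, s\<^sup>2 - 1\<close>
  form \<open>s\<close> groups of \<open>s\<close> consecutive ranks. Scalar 4 is the counter of all loops except the one over
  the \<open>s\<^sup>3\<close> matrix products, and scalar 5 holds \<open>s\<^sup>2\<close>. Word arrays: 4, the rank of a vertex in the order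
  by weight; 5, the vertex of a given rank; 6, the adjacency matrix with columns permuted by rank and
  with rows of length \<open>s\<^sup>2\<close>; 7, one more than the last group of ranks containing a common neighbour of
  two vertices, or 0 if there is none.
\<close>

abbreviation size_exp :: iexp where "size_exp \<equiv> IRead 0 (IConst 0)"

text \<open>The square root of n, rounded up, is found by incrementing scalar 0 as long as its
  square is below n; n rounds are enough since n \<le> n * n.\<close>

definition set_scalars :: "int \<Rightarrow> com" where
  "set_scalars D =
     Seq (For 4 size_exp (Cond (BNot (ILe size_exp (IMul (scalar 0) (scalar 0))))
           (IWrite 3 (IConst 0) (IAdd (scalar 0) (IConst 1))) Skip))
    (Seq (IWrite 3 (IConst 1) (IAdd (IMul (IConst D) (scalar 0)) (IConst 1)))
    (Seq (IWrite 3 (IConst 5) (IMul (scalar 0) (scalar 0)))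
         (IWrite 3 (IConst 2) (IMul (scalar 5) (scalar 0)))))"

text \<open>The strict lexicographic order by weight and then by index, expressed through \<le>
  tests. Breaking ties by index makes the ranks distinct.\<close>

definition lighter :: "iexp \<Rightarrow> iexp \<Rightarrow> bexp" where
  "lighter u v = BAnd (RLe (RRead 0 u) (RRead 0 v))
     (BNot (BAnd (RLe (RRead 0 v) (RRead 0 u)) (ILe v u)))"

text \<open>Sorting by counting, for every v, the vertices before it. Its quadratic time is within
  the budget. As in the other loops over pairs, one counter encodes both indices.\<close>

definition compute_ranks :: com where
  "compute_ranks =
     (let v = IDiv (scalar 4) size_exp; u = IMod (scalar 4) size_exp in
      For 4 (IMul size_exp size_exp)
        (Cond (lighter u v) (IWrite 4 v (IAdd (IRead 4 v) (IConst 1))) Skip))"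

definition invert_ranks :: com where
  "invert_ranks = For 4 size_exp (IWrite 5 (IRead 4 (scalar 4)) (scalar 4))"

text \<open>Only n^2 entries are written. The padding to an s^2 by s^2 matrix consists of cells that
  are still 0, so padding indices behave like isolated vertices.\<close>

definition permute_columns :: com where
  "permute_columns =
     (let u = IDiv (scalar 4) size_exp; v = IMod (scalar 4) size_exp in
      For 4 (IMul size_exp size_exp)
        (IWrite 6 (IAdd (IMul u (scalar 5)) (IRead 4 v)) (IRead 1 (scalar 4))))"

abbreviation group_exp :: iexp where "group_exp \<equiv> IDiv (scalar 3) (scalar 5)"

text \<open>The second block is loaded transposed: position (a, b) of the second factor concerns
  vertex b of block j and rank a of the group. The product then sums over the ranks of the
  group.\<close>

definition load_blocks :: com where
  "load_blocks =
     (let a = IDiv (scalar 4) (scalar 0); b = IMod (scalar 4) (scalar 0);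
          i = IMod (IDiv (scalar 3) (scalar 0)) (scalar 0); j = IMod (scalar 3) (scalar 0);
          entry = (\<lambda>i a c. IRead 6 (IAdd (IMul (IAdd (IMul i (scalar 0)) a) (scalar 5))
            (IAdd (IMul group_exp (scalar 0)) c))) in
      Seq (IWrite 8 (cell_of_run (IConst 0)) (scalar 0))
        (For 4 (scalar 5)
          (Seq (IWrite 9 (cell_of_run (scalar 4)) (entry i a b))
               (IWrite 11 (cell_of_run (scalar 4)) (entry j b a)))))"

text \<open>The group is the leading digit of the product number, so for a fixed pair of vertices
  the groups come in increasing order and plain overwriting leaves the last one.\<close>

definition update_groups :: com where
  "update_groups =
     (let i = IAdd (IMul (IMod (IDiv (scalar 3) (scalar 0)) (scalar 0)) (scalar 0)) (IDiv (scalar 4) (scalar 0));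
          j = IAdd (IMul (IMod (scalar 3) (scalar 0)) (scalar 0)) (IMod (scalar 4) (scalar 0)) in
      For 4 (scalar 5)
        (Cond (ILe (IConst 1) (IRead 13 (cell_of_run (scalar 4))))
          (IWrite 7 (IAdd (IMul i (scalar 5)) j) (IAdd group_exp (IConst 1))) Skip))"

definition find_groups :: "int \<Rightarrow> com \<Rightarrow> com" where
  "find_groups D M = For 3 (scalar 2) (Seq load_blocks (Seq (sim_com D M) update_groups))"

text \<open>If g is 0, the position r is meaningless, but the conjunct on g already fails. The
  weight of the best triangle so far is recomputed from its recorded vertices.\<close>

definition scan_groups :: com where
  "scan_groups =
     (let u = IDiv (IDiv (scalar 4) (scalar 0)) size_exp; v = IMod (IDiv (scalar 4) (scalar 0)) size_exp;
          g = IRead 7 (IAdd (IMul u (scalar 5)) v);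
          r = IAdd (IMul (ISub g (IConst 1)) (scalar 0)) (IMod (scalar 4) (scalar 0));
          x = IRead 5 r;
          out = (\<lambda>k. IRead 2 (IConst k));
          weight = (\<lambda>u v x. RAdd (RAdd (RRead 0 u) (RRead 0 v)) (RRead 0 x)) in
      For 4 (IMul (IMul size_exp size_exp) (scalar 0))
        (Cond (BAnd (ILe (IConst 1) (IRead 1 (IDiv (scalar 4) (scalar 0))))
              (BAnd (ILe (IConst 1) g)
              (BAnd (ILe (IConst 1) (IRead 6 (IAdd (IMul u (scalar 5)) r)))
              (BAnd (ILe (IConst 1) (IRead 6 (IAdd (IMul v (scalar 5)) r)))
                    (BNot (BAnd (ILe (IConst 1) (out 0))
                      (RLe (weight u v x) (weight (out 1) (out 2) (out 3)))))))))
          (Seq (IWrite 2 (IConst 1) u) (Seq (IWrite 2 (IConst 2) v)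
          (Seq (IWrite 2 (IConst 3) x) (IWrite 2 (IConst 0) (IConst 1))))) Skip))"

definition max_triangle_program :: "int \<Rightarrow> com \<Rightarrow> com" where
  "max_triangle_program D M =
     Seq (set_scalars D) (Seq compute_ranks (Seq invert_ranks (Seq permute_columns
       (Seq (find_groups D M) scan_groups))))"

lemmas program_defs = set_scalars_def compute_ranks_def invert_ranks_def permute_columns_def
  find_groups_def load_blocks_def update_groups_def scan_groups_def lighter_def Let_def

lemma comparison_addition_program: "comparison_addition (max_triangle_program D M)"
  by (simp add: max_triangle_program_def program_defs comparison_addition_For comparison_addition_sim_com)

lemma deterministic_program: "deterministic (max_triangle_program D M)"
  by (simp add: max_triangle_program_def program_defs deterministic_For deterministic_sim_com)

section \<open>Ranks and groups\<close>

lemma row_major_inj: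
  fixes r r' N :: nat
  assumes "r < N" "r' < N"
  shows "u * N + r = u' * N + r' \<longleftrightarrow> u = u' \<and> r = r'"
proof
  assume *: "u * N + r = u' * N + r'"
  have "(u * N + r) div N = u" "(u' * N + r') div N = u'" "(u * N + r) mod N = r" "(u' * N + r') mod N = r'"
    using assms by simp_all
  then show "u = u' \<and> r = r'" using * by metis
qed auto

lemma row_major_inj_int:
  assumes "r < N" "r' < N"
  shows "int u * int N + int r = int u' * int N + int r' \<longleftrightarrow> u = u' \<and> r = r'"
proof -
  have "int u * int N + int r = int u' * int N + int r' \<longleftrightarrow> int (u * N + r) = int (u' * N + r')"
    by simp
  then show ?thesis using row_major_inj[OF assms, of u u'] by (simp only: of_nat_eq_iff)
qed

lemma row_major_less:
  fixes a b :: nat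
  assumes "a < k" "b < s"
  shows "a * s + b < k * s"
proof -
  have "a * s + b < Suc a * s" using assms(2) by simp
  also have "\<dots> \<le> k * s" using assms(1) by (intro mult_le_mono1) simp
  finally show ?thesis .
qed

locale weighted_graph =
  fixes n :: nat and E :: "nat set set" and w :: "nat \<Rightarrow> real"
  assumes simple: "simple_graph n E"
begin

definition lighter_vertex :: "nat \<Rightarrow> nat \<Rightarrow> bool" where
  "lighter_vertex u v \<longleftrightarrow> w u \<le> w v \<and> \<not> (w v \<le> w u \<and> v \<le> u)"

definition rank :: "nat \<Rightarrow> nat" where
  "rank v = card {u. u < n \<and> lighter_vertex u v}"

lemma rank_less: "v < n \<Longrightarrow> rank v < n"
proof -
  assume "v < n"
  then have "{u. u < n \<and> lighter_vertex u v} \<subset> {..<n}" by (auto simp: lighter_vertex_def)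
  then have "rank v < card {..<n}" unfolding rank_def by (intro psubset_card_mono) auto
  then show ?thesis by simp
qed

text \<open>Transitivity gives an inclusion of the two sets of lighter vertices, and u itself makes
  it strict.\<close>

lemma rank_strict_mono:
  assumes "lighter_vertex u v" "u < n"
  shows "rank u < rank v"
  unfolding rank_def
proof (rule psubset_card_mono)
  have "u \<in> {x. x < n \<and> lighter_vertex x v}" "u \<notin> {x. x < n \<and> lighter_vertex x u}"
    using assms by (auto simp: lighter_vertex_def)
  moreover have "{x. x < n \<and> lighter_vertex x u} \<subseteq> {x. x < n \<and> lighter_vertex x v}"
    using assms by (auto simp: lighter_vertex_def)
  ultimately show "{x. x < n \<and> lighter_vertex x u} \<subset> {x. x < n \<and> lighter_vertex x v}" by blast
qed simp

lemma rank_inj: "u < n \<Longrightarrow> v < n \<Longrightarrow> rank u = rank v \<longleftrightarrow> u = v"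
proof
  assume *: "u < n" "v < n" "rank u = rank v"
  have "lighter_vertex u v \<or> lighter_vertex v u \<or> u = v" by (auto simp: lighter_vertex_def)
  then show "u = v" using rank_strict_mono[of u v] rank_strict_mono[of v u] * by auto
qed auto

lemma rank_weight: "v < n \<Longrightarrow> rank u \<le> rank v \<Longrightarrow> w u \<le> w v"
  using rank_strict_mono[of v u] by (force simp: lighter_vertex_def)

definition groups :: nat where
  "groups = (LEAST s. n \<le> s * s)"

lemma n_le_groups_square: "n \<le> groups * groups"
  unfolding groups_def by (rule LeastI[of _ n]) (rule le_square)

lemma groups_le: "n \<le> s * s \<Longrightarrow> groups \<le> s"
  unfolding groups_def by (rule Least_le)

lemma groups_le_n: "groups \<le> n"
  by (rule groups_le) (rule le_square)

text \<open>False when u or r is n or more, so one formula describes the padded matrix at all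
  indices below s^2.\<close>

definition rank_adjacent :: "nat \<Rightarrow> nat \<Rightarrow> bool" where
  "rank_adjacent u r \<longleftrightarrow> u < n \<and> (\<exists>v<n. r = rank v \<and> {u, v} \<in> E)"

definition common_in_group :: "nat \<Rightarrow> nat \<Rightarrow> nat \<Rightarrow> bool" where
  "common_in_group u v g \<longleftrightarrow>
     (\<exists>c<groups. rank_adjacent u (g * groups + c) \<and> rank_adjacent v (g * groups + c))"

lemma edge_less: "{u, v} \<in> E \<Longrightarrow> u < n \<and> v < n \<and> u \<noteq> v"
proof -
  assume "{u, v} \<in> E"
  then obtain u' v' where "{u, v} = {u', v'}" "u' < n" "v' < n" "u' \<noteq> v'"
    using simple unfolding simple_graph_def by blast
  then show ?thesis by (auto simp: doubleton_eq_iff)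
qed

end

section \<open>Correctness of the program\<close>

text \<open>\<open>TM\<close> and \<open>BM\<close> bound the time and the words of \<open>M\<close>
  for matrices of the dimension s at hand.\<close>

locale triangle_search = weighted_graph +
  fixes D m B BM :: int and M :: com and TM s N K :: nat
  assumes D_pos: "D > 0"
    and m_def: "m = D * int s + 1"
    and s_def: "s = groups"
    and N_def: "N = s * s"
    and K_def: "K = N * s"
    and B: "int (n * n * n) \<le> B" "int n \<le> B" "m \<le> B" "BM \<le> B"
    and M: "arithmetic M" "clears D M"
    and M_correct: "\<And>X Y. s > 0 \<Longrightarrow> X \<in> carrier_mat s s \<Longrightarrow> Y \<in> carrier_mat s s \<Longrightarrow>
      \<exists>t \<tau>. exec BM M (matrix_input s X Y) t \<tau> \<and> t \<le> TM \<and> matrix_output s (X * Y) \<tau>"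
begin

lemma s_le_n: "s \<le> n"
  using groups_le_n s_def by simp

lemma n_le_N: "n \<le> N"
  using n_le_groups_square s_def N_def by simp

lemma n_le_cube: "n * n \<le> n * n * n"
  by (cases n) auto

lemma B_ge:
  "k \<le> n \<Longrightarrow> int k \<le> B" "k \<le> n * n \<Longrightarrow> int k \<le> B" "k \<le> n * n * s \<Longrightarrow> int k \<le> B"
  "k \<le> N \<Longrightarrow> int k \<le> B" "k \<le> K \<Longrightarrow> int k \<le> B"
proof -
  have N: "N \<le> n * n" using s_le_n by (simp add: N_def mult_le_mono)
  have s: "n * n * s \<le> n * n * n" using s_le_n by simp
  have K: "K \<le> n * n * n" unfolding K_def using N s_le_n by (rule mult_le_mono)
  have "int k \<le> B" if "k \<le> n * n * n" for k using that B(1) by linarith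
  from this[of k] N s K n_le_cube
  show "k \<le> n * n \<Longrightarrow> int k \<le> B" "k \<le> n * n * s \<Longrightarrow> int k \<le> B"
    "k \<le> N \<Longrightarrow> int k \<le> B" "k \<le> K \<Longrightarrow> int k \<le> B"
    by linarith+
  show "k \<le> n \<Longrightarrow> int k \<le> B" using B(2) by linarith
qed

section \<open>Memory invariants and the preparatory phases\<close>

definition holds_graph :: "state \<Rightarrow> bool" where
  "holds_graph \<sigma> \<longleftrightarrow> imem \<sigma> 0 0 = int n \<and>
     (\<forall>u<n. \<forall>v<n. imem \<sigma> 1 (int u * int n + int v) = of_bool ({u, v} \<in> E)) \<and>
     (\<forall>v<n. rmem \<sigma> 0 (int v) = w v)"

definition holds_scalars :: "state \<Rightarrow> bool" where
  "holds_scalars \<sigma> \<longleftrightarrow> imem \<sigma> 3 0 = int s \<and> imem \<sigma> 3 1 = m \<and> imem \<sigma> 3 2 = int K \<and> imem \<sigma> 3 5 = int N"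

text \<open>Array 2 is kept clear for the output. The parameter k rises as the phases take the
  arrays 4, 5 and 6 into use.\<close>

definition blank :: "nat \<Rightarrow> state \<Rightarrow> bool" where
  "blank k \<sigma> \<longleftrightarrow> (\<forall>c. imem \<sigma> 2 c = 0) \<and> (\<forall>a\<ge>k. \<forall>i. imem \<sigma> a i = 0)"

definition holds_order :: "state \<Rightarrow> bool" where
  "holds_order \<sigma> \<longleftrightarrow> (\<forall>v<n. imem \<sigma> 5 (int (rank v)) = int v)"

definition holds_columns :: "state \<Rightarrow> bool" where
  "holds_columns \<sigma> \<longleftrightarrow>
     (\<forall>u<N. \<forall>r<N. imem \<sigma> 6 (int u * int N + int r) = of_bool (rank_adjacent u r))"

lemma holds_graph_iwrite [simp]: "1 < a \<Longrightarrow> holds_graph (iwrite a i v \<sigma>) = holds_graph \<sigma>"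
  by (simp add: holds_graph_def)

lemma holds_scalars_iwrite [simp]: "a \<noteq> 3 \<or> i = 3 \<or> i = 4 \<Longrightarrow> holds_scalars (iwrite a i v \<sigma>) = holds_scalars \<sigma>"
  by (auto simp: holds_scalars_def)

lemma blank_iwrite [simp]: "a < k \<Longrightarrow> a \<noteq> 2 \<Longrightarrow> blank k (iwrite a i v \<sigma>) = blank k \<sigma>"
  by (auto simp: blank_def)

lemma holds_order_iwrite [simp]: "a \<noteq> 5 \<Longrightarrow> holds_order (iwrite a i v \<sigma>) = holds_order \<sigma>"
  by (simp add: holds_order_def)

lemma holds_columns_iwrite [simp]: "a \<noteq> 6 \<Longrightarrow> holds_columns (iwrite a i v \<sigma>) = holds_columns \<sigma>"
  by (simp add: holds_columns_def)

lemma set_scalars_correct: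
  assumes "holds_graph \<sigma>" "blank 4 \<sigma>" "\<forall>c. imem \<sigma> 3 c = 0"
  shows "achieves B (set_scalars D) \<sigma> (6 * n + 10) (\<lambda>\<sigma>. holds_graph \<sigma> \<and> blank 4 \<sigma> \<and> holds_scalars \<sigma>)"
  unfolding set_scalars_def
proof (rule achieves_Seq)
  \<comment> \<open>Scalar 0 equals the counter until its square reaches n, and lags behind from
    then on. At the end either it lags, or it is n; in both cases n is at most its square.\<close>
  let ?I = "\<lambda>y \<sigma>. holds_graph \<sigma> \<and> blank 4 \<sigma> \<and> imem \<sigma> 3 4 = int y \<and>
    (\<exists>r\<le>y. imem \<sigma> 3 0 = int r \<and> (\<forall>t<r. t * t < n) \<and> (r < y \<longrightarrow> n \<le> r * r))"
  show "achieves B (For 4 size_exp (Cond (BNot (ILe size_exp (IMul (scalar 0) (scalar 0))))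
           (IWrite 3 (IConst 0) (IAdd (scalar 0) (IConst 1))) Skip)) \<sigma> (6 * n + 3)
    (\<lambda>\<sigma>. holds_graph \<sigma> \<and> blank 4 \<sigma> \<and> imem \<sigma> 3 0 = int s)"
  proof (rule achieves_For[where Inv = ?I and N = n and T = 2])
    show "?I 0 (iwrite 3 4 0 \<sigma>)" using assms by simp
    show "imem \<sigma> 3 4 = int y \<and> ival size_exp \<sigma> = int n" if "?I y \<sigma>" for y \<sigma>
      using that by (simp add: holds_graph_def)
    show "holds_graph \<sigma> \<and> blank 4 \<sigma> \<and> imem \<sigma> 3 0 = int s" if I: "?I n \<sigma>" for \<sigma>
    proof -
      obtain r where r: "r \<le> n" "imem \<sigma> 3 0 = int r" "\<forall>t<r. t * t < n" "r < n \<longrightarrow> n \<le> r * r"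
        using I by blast
      have "n \<le> r * r" using r by (cases "r < n") auto
      then have "groups \<le> r" by (rule groups_le)
      moreover have "r \<le> groups" using r(3) n_le_groups_square by (meson not_le)
      ultimately show ?thesis using I r s_def by simp
    qed
    show "int n \<le> B" by (fact B)
    show "n * (2 + 4) + 3 \<le> 6 * n + 3" by simp
    fix y \<sigma> assume y: "y < n" and I: "?I y \<sigma>"
    then obtain r where r: "r \<le> y" "imem \<sigma> 3 0 = int r" "\<forall>t<r. t * t < n" "r < y \<longrightarrow> n \<le> r * r"
      by blast
    have n: "imem \<sigma> 0 0 = int n" using I by (simp add: holds_graph_def)
    have sq: "int n \<le> int r * int r \<longleftrightarrow> n \<le> r * r" by (simp flip: of_nat_mult)
    show "achieves B (Cond (BNot (ILe size_exp (IMul (scalar 0) (scalar 0))))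
           (IWrite 3 (IConst 0) (IAdd (scalar 0) (IConst 1))) Skip) \<sigma> 2
      (\<lambda>\<sigma>'. imem \<sigma>' 3 4 = int y \<and> ?I (Suc y) (iwrite 3 4 (int (Suc y)) \<sigma>'))"
    proof (rule achieves_Cond[where T = 1])
      assume "bval (BNot (ILe size_exp (IMul (scalar 0) (scalar 0)))) \<sigma>"
      then have *: "r * r < n" using n r(2) sq by simp
      then have "r = y" using r by auto
      have "Suc r \<le> Suc y \<and> int r + 1 = int (Suc r) \<and> (\<forall>t<Suc r. t * t < n) \<and> (Suc r < Suc y \<longrightarrow> n \<le> Suc r * Suc r)"
        using * r \<open>r = y\<close> by (auto simp: less_Suc_eq)
      then show "achieves B (IWrite 3 (IConst 0) (IAdd (scalar 0) (IConst 1))) \<sigma> 1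
          (\<lambda>\<sigma>'. imem \<sigma>' 3 4 = int y \<and> ?I (Suc y) (iwrite 3 4 (int (Suc y)) \<sigma>'))"
        using I y r(1,2) B(2) by (intro achieves_IWrite) (auto intro!: exI[of _ "Suc r"])
    next
      assume "\<not> bval (BNot (ILe size_exp (IMul (scalar 0) (scalar 0)))) \<sigma>"
      then have "n \<le> r * r" using n r(2) sq by simp
      then show "achieves B Skip \<sigma> 1
          (\<lambda>\<sigma>'. imem \<sigma>' 3 4 = int y \<and> ?I (Suc y) (iwrite 3 4 (int (Suc y)) \<sigma>'))"
        using I y r by (intro achieves_Skip) (auto intro!: exI[of _ r])
    qed simp
  qed
next
  fix \<sigma> assume *: "holds_graph \<sigma> \<and> blank 4 \<sigma> \<and> imem \<sigma> 3 0 = int s"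
  have m: "m > 0" using D_pos by (simp add: m_def add_nonneg_pos)
  have N: "int s * int s = int N" "int N * int s = int K" "D * int s + 1 = m"
    by (simp_all add: N_def K_def m_def)
  show "achieves B (Seq (IWrite 3 (IConst 1) (IAdd (IMul (IConst D) (scalar 0)) (IConst 1)))
     (Seq (IWrite 3 (IConst 5) (IMul (scalar 0) (scalar 0)))
       (IWrite 3 (IConst 2) (IMul (scalar 5) (scalar 0))))) \<sigma> 5
     (\<lambda>\<sigma>. holds_graph \<sigma> \<and> blank 4 \<sigma> \<and> holds_scalars \<sigma>)"
    apply (rule achieves_IWrite_Seq[where U = 3])
      subgoal using * N B(3) m by simp
     apply (rule achieves_IWrite_Seq[where U = 1])
       subgoal using * N B_ge(4)[of N] by simp
      apply (rule achieves_IWrite)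
        subgoal using * N B_ge(5)[of K] by simp
       apply simp
      subgoal using * N by (simp add: holds_scalars_def)
     apply simp_all
    done
qed simp

lemma square_index:
  assumes "y < n * n"
  obtains u v where "u < n" "v < n" "y = u * n + v" "int y div int n = int u" "int y mod int n = int v"
proof
  have "n > 0" using assms by (cases n) auto
  then show "y div n < n" "y mod n < n" using assms by (simp_all add: less_mult_imp_div_less)
qed (simp_all add: zdiv_int zmod_int)

lemma compute_ranks_correct:
  assumes "holds_graph \<sigma>" "blank 4 \<sigma>" "holds_scalars \<sigma>"
  shows "achieves B compute_ranks \<sigma> (6 * (n * n) + 3)
    (\<lambda>\<sigma>. holds_graph \<sigma> \<and> blank 5 \<sigma> \<and> holds_scalars \<sigma> \<and> (\<forall>v<n. imem \<sigma> 4 (int v) = int (rank v)))"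
  unfolding compute_ranks_def Let_def
proof (rule achieves_For[where N = "n * n" and T = 2])
  let ?S = "\<lambda>y v. {u. u < n \<and> v * n + u < y \<and> lighter_vertex u v}"
  let ?I = "\<lambda>y \<sigma>. holds_graph \<sigma> \<and> blank 5 \<sigma> \<and> holds_scalars \<sigma> \<and> imem \<sigma> 3 4 = int y \<and>
    (\<forall>v<n. imem \<sigma> 4 (int v) = int (card (?S y v)))"
  show "?I 0 (iwrite 3 4 0 \<sigma>)" using assms by (auto simp: blank_def)
  show "imem \<sigma> 3 4 = int y \<and> ival (IMul size_exp size_exp) \<sigma> = int (n * n)" if "?I y \<sigma>" for y \<sigma>
    using that by (simp add: holds_graph_def)
  show "int (n * n) \<le> B" by (rule B_ge(2)) simp
  show "n * n * (2 + 4) + 3 \<le> 6 * (n * n) + 3" by simp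
  show "holds_graph \<sigma> \<and> blank 5 \<sigma> \<and> holds_scalars \<sigma> \<and> (\<forall>v<n. imem \<sigma> 4 (int v) = int (rank v))"
    if I: "?I (n * n) \<sigma>" for \<sigma>
  proof -
    have "?S (n * n) v = {u. u < n \<and> lighter_vertex u v}" if "v < n" for v
      using row_major_less[OF that, of _ n] by auto
    then show ?thesis using I by (simp add: rank_def)
  qed
  fix y \<sigma> assume y: "y < n * n" and I: "?I y \<sigma>"
  let ?v = "IDiv (scalar 4) size_exp" and ?u = "IMod (scalar 4) size_exp"
  obtain v u where uv: "u < n" "v < n" "y = v * n + u" "int y div int n = int v" "int y mod int n = int u"
    using square_index[OF y] by metis
  have val: "ival ?v \<sigma> = int v" "ival ?u \<sigma> = int u" using I uv by (simp_all add: holds_graph_def)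
  have b: "bval (lighter ?u ?v) \<sigma> \<longleftrightarrow> lighter_vertex u v"
    using I uv(1,2) unfolding lighter_def bval.simps rval.simps val lighter_vertex_def
    by (simp add: holds_graph_def)
  have S: "?S (Suc y) v' = (if v' = v \<and> lighter_vertex u v then insert u (?S y v') else ?S y v')" if "v' < n" for v'
  proof -
    have "v' * n + u' < Suc y \<longleftrightarrow> v' * n + u' < y \<or> (v' = v \<and> u' = u)" if "u' < n" for u'
      using row_major_inj[OF that uv(1), of v' v] uv(3) by (simp add: less_Suc_eq)
    then show ?thesis using uv(1) by auto
  qed
  have un: "u \<notin> ?S y v" using uv(3) by simp
  show "achieves B (Cond (lighter ?u ?v) (IWrite 4 ?v (IAdd (IRead 4 ?v) (IConst 1))) Skip) \<sigma> 2
      (\<lambda>\<sigma>'. imem \<sigma>' 3 4 = int y \<and> ?I (Suc y) (iwrite 3 4 (int (Suc y)) \<sigma>'))"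
  proof (rule achieves_Cond[where T = 1])
    assume "bval (lighter ?u ?v) \<sigma>"
    then have l: "lighter_vertex u v" using b by simp
    have c: "card (?S (Suc y) v) = Suc (card (?S y v))" using S[OF uv(2)] l un by simp
    have val2: "ival (IAdd (IRead 4 ?v) (IConst 1)) \<sigma> = int (card (?S (Suc y) v))"
      using I uv(2) c val by simp
    have "card (?S (Suc y) v) \<le> card {..<n}" by (intro card_mono) auto
    then have "int (card (?S (Suc y) v)) \<le> B" by (intro B_ge(1)) simp
    then show "achieves B (IWrite 4 ?v (IAdd (IRead 4 ?v) (IConst 1))) \<sigma> 1
      (\<lambda>\<sigma>'. imem \<sigma>' 3 4 = int y \<and> ?I (Suc y) (iwrite 3 4 (int (Suc y)) \<sigma>'))"
      using I val2 S by (intro achieves_IWrite) (auto simp: val simp del: ival.simps)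
  next
    assume "\<not> bval (lighter ?u ?v) \<sigma>"
    then show "achieves B Skip \<sigma> 1
      (\<lambda>\<sigma>'. imem \<sigma>' 3 4 = int y \<and> ?I (Suc y) (iwrite 3 4 (int (Suc y)) \<sigma>'))"
      using I b S by (intro achieves_Skip) auto
  qed simp
qed

lemma invert_ranks_correct:
  assumes "holds_graph \<sigma>" "blank 5 \<sigma>" "holds_scalars \<sigma>" "\<forall>v<n. imem \<sigma> 4 (int v) = int (rank v)"
  shows "achieves B invert_ranks \<sigma> (5 * n + 3)
    (\<lambda>\<sigma>. holds_graph \<sigma> \<and> blank 6 \<sigma> \<and> holds_scalars \<sigma> \<and> (\<forall>v<n. imem \<sigma> 4 (int v) = int (rank v)) \<and> holds_order \<sigma>)"
  unfolding invert_ranks_def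
proof (rule achieves_For[where N = n and T = 1])
  let ?I = "\<lambda>y \<sigma>. holds_graph \<sigma> \<and> blank 6 \<sigma> \<and> holds_scalars \<sigma> \<and> (\<forall>v<n. imem \<sigma> 4 (int v) = int (rank v)) \<and>
    imem \<sigma> 3 4 = int y \<and> (\<forall>v<y. imem \<sigma> 5 (int (rank v)) = int v)"
  show "?I 0 (iwrite 3 4 0 \<sigma>)" using assms by (auto simp: blank_def)
  show "imem \<sigma> 3 4 = int y \<and> ival size_exp \<sigma> = int n" if "?I y \<sigma>" for y \<sigma>
    using that by (simp add: holds_graph_def)
  fix y \<sigma> assume y: "y < n" and I: "?I y \<sigma>"
  \<comment> \<open>Ranks are distinct, so the write spares the entries of earlier vertices.\<close>
  show "achieves B (IWrite 5 (IRead 4 (scalar 4)) (scalar 4)) \<sigma> 1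
     (\<lambda>\<sigma>'. imem \<sigma>' 3 4 = int y \<and> ?I (Suc y) (iwrite 3 4 (int (Suc y)) \<sigma>'))"
    using I y B(2) by (intro achieves_IWrite) (auto simp: less_Suc_eq rank_inj)
next
  show "int n \<le> B" by (fact B)
  show "n * (1 + 4) + 3 \<le> 5 * n + 3" by simp
qed (simp add: holds_order_def)

lemma permute_columns_correct:
  assumes "holds_graph \<sigma>" "blank 6 \<sigma>" "holds_scalars \<sigma>" "\<forall>v<n. imem \<sigma> 4 (int v) = int (rank v)" "holds_order \<sigma>"
  shows "achieves B permute_columns \<sigma> (5 * (n * n) + 3)
    (\<lambda>\<sigma>. holds_graph \<sigma> \<and> blank 7 \<sigma> \<and> holds_scalars \<sigma> \<and> holds_order \<sigma> \<and> holds_columns \<sigma>)"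
  unfolding permute_columns_def Let_def
proof (rule achieves_For[where N = "n * n" and T = 1])
  define R where "R y u r \<longleftrightarrow> u < n \<and> (\<exists>v<n. r = rank v \<and> {u, v} \<in> E \<and> u * n + v < y)" for y u r
  let ?I = "\<lambda>y \<sigma>. holds_graph \<sigma> \<and> blank 7 \<sigma> \<and> holds_scalars \<sigma> \<and> (\<forall>v<n. imem \<sigma> 4 (int v) = int (rank v)) \<and>
    holds_order \<sigma> \<and> imem \<sigma> 3 4 = int y \<and>
    (\<forall>u<N. \<forall>r<N. imem \<sigma> 6 (int u * int N + int r) = of_bool (R y u r))"
  show "?I 0 (iwrite 3 4 0 \<sigma>)" using assms by (auto simp: blank_def R_def)
  show "imem \<sigma> 3 4 = int y \<and> ival (IMul size_exp size_exp) \<sigma> = int (n * n)" if "?I y \<sigma>" for y \<sigma>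
    using that by (simp add: holds_graph_def)
  show "int (n * n) \<le> B" by (rule B_ge(2)) simp
  show "n * n * (1 + 4) + 3 \<le> 5 * (n * n) + 3" by simp
  show "holds_graph \<sigma> \<and> blank 7 \<sigma> \<and> holds_scalars \<sigma> \<and> holds_order \<sigma> \<and> holds_columns \<sigma>" if I: "?I (n * n) \<sigma>" for \<sigma>
  proof -
    have "R (n * n) u r \<longleftrightarrow> rank_adjacent u r" for u r
      using row_major_less[of u n _ n] by (auto simp: rank_adjacent_def R_def)
    then show ?thesis using I by (simp add: holds_columns_def)
  qed
  fix y \<sigma> assume y: "y < n * n" and I: "?I y \<sigma>"
  let ?u = "IDiv (scalar 4) size_exp" and ?v = "IMod (scalar 4) size_exp"
  obtain u v where uv: "u < n" "v < n" "y = u * n + v" "int y div int n = int u" "int y mod int n = int v"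
    using square_index[OF y] by metis
  have val: "ival (IAdd (IMul ?u (scalar 5)) (IRead 4 ?v)) \<sigma> = int u * int N + int (rank v)"
    "ival (IRead 1 (scalar 4)) \<sigma> = of_bool ({u, v} \<in> E)"
    using I uv by (simp_all add: holds_graph_def holds_scalars_def)
  \<comment> \<open>Row-major positions and ranks are both injective, so round y decides exactly one
    entry of the permuted matrix.\<close>
  have R_Suc: "R (Suc y) u' r \<longleftrightarrow> (if u' = u \<and> r = rank v then {u, v} \<in> E else R y u' r)" for u' r
  proof -
    have "u' * n + v' < Suc y \<longleftrightarrow> u' * n + v' < y \<or> (u' = u \<and> v' = v)" if "v' < n" for v'
      using row_major_inj[OF that uv(2), of u' u] uv(3) by (simp add: less_Suc_eq)
    then show ?thesis using uv(1,2,3) rank_inj by (auto simp: R_def split: if_splits)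
  qed
  have rv: "rank v < N" using rank_less[OF uv(2)] n_le_N by simp
  have "1 \<le> B" using B(2) uv(1) by simp
  show "achieves B (IWrite 6 (IAdd (IMul ?u (scalar 5)) (IRead 4 ?v)) (IRead 1 (scalar 4))) \<sigma> 1
      (\<lambda>\<sigma>'. imem \<sigma>' 3 4 = int y \<and> ?I (Suc y) (iwrite 3 4 (int (Suc y)) \<sigma>'))"
  proof (rule achieves_IWrite)
    show "\<bar>ival (IRead 1 (scalar 4)) \<sigma>\<bar> \<le> B" using \<open>1 \<le> B\<close> unfolding val by simp
    show "imem (iwrite 6 (ival (IAdd (IMul ?u (scalar 5)) (IRead 4 ?v)) \<sigma>) (ival (IRead 1 (scalar 4)) \<sigma>) \<sigma>) 3 4 = int y \<and>
      ?I (Suc y) (iwrite 3 4 (int (Suc y))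
        (iwrite 6 (ival (IAdd (IMul ?u (scalar 5)) (IRead 4 ?v)) \<sigma>) (ival (IRead 1 (scalar 4)) \<sigma>) \<sigma>))"
      unfolding val using I by (simp add: R_Suc row_major_inj_int[OF _ rv])
  qed simp
qed

section \<open>The matrix products and the last groups\<close>

text \<open>
  Matrix product number \<open>x = (g * s + I) * s + J\<close> finds the common neighbours in group \<open>g\<close> of the
  vertices of the blocks \<open>I\<close> and \<open>J\<close>. Its first \<open>y\<close> entries have been evaluated.
\<close>

definition grouped :: "nat \<Rightarrow> nat \<Rightarrow> state \<Rightarrow> bool" where
  "grouped x y \<sigma> \<longleftrightarrow> (\<forall>i<N. \<forall>j<N. \<exists>b\<le>s. imem \<sigma> 7 (int i * int N + int j) = int b \<and>
     (b > 0 \<longrightarrow> common_in_group i j (b - 1)) \<and>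
     (\<forall>g<s. ((g * s + i div s) * s + j div s < x \<or>
        (g * s + i div s) * s + j div s = x \<and> (i mod s) * s + j mod s < y) \<longrightarrow>
        common_in_group i j g \<longrightarrow> g < b))"

definition prepared :: "nat \<Rightarrow> state \<Rightarrow> bool" where
  "prepared x \<sigma> \<longleftrightarrow> holds_graph \<sigma> \<and> (\<forall>c. imem \<sigma> 2 c = 0) \<and> holds_scalars \<sigma> \<and> holds_order \<sigma> \<and>
     holds_columns \<sigma> \<and> imem \<sigma> 3 3 = int x"

text \<open>The address classes of product number x and of all later ones are still zero, as
  \<open>M\<close> requires of its initial memory.\<close>

definition fresh :: "nat \<Rightarrow> state \<Rightarrow> bool" where
  "fresh x \<sigma> \<longleftrightarrow> (\<forall>a\<ge>8. \<forall>j. j mod int K \<ge> int x \<longrightarrow> imem \<sigma> a j = 0)"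

text \<open>The zeros of class x are described too, because \<open>represents\<close> compares every
  cell with \<open>matrix_input\<close>.\<close>

definition loaded :: "nat \<Rightarrow> nat \<Rightarrow> nat \<Rightarrow> nat \<Rightarrow> nat \<Rightarrow> state \<Rightarrow> bool" where
  "loaded x g I J y \<sigma> \<longleftrightarrow> (\<forall>a\<ge>8. \<forall>i. imem \<sigma> a (i * int K + int x) =
     (if a = 8 then (if i = 0 then int s else 0)
      else if a = 9 then of_bool (0 \<le> i \<and> i < int y \<and>
        rank_adjacent (I * s + nat i div s) (g * s + nat i mod s))
      else if a = 11 then of_bool (0 \<le> i \<and> i < int y \<and>
        rank_adjacent (J * s + nat i mod s) (g * s + nat i div s))
      else 0))"

lemma grouped_iwrite [simp]: "a \<noteq> 7 \<Longrightarrow> grouped x y (iwrite a i v \<sigma>) = grouped x y \<sigma>"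
  by (simp add: grouped_def)

lemma groupedE:
  assumes "grouped x y \<sigma>" "i < N" "j < N"
  obtains b where "b \<le> s" "imem \<sigma> 7 (int i * int N + int j) = int b"
    "b > 0 \<Longrightarrow> common_in_group i j (b - 1)"
    "\<And>g. g < s \<Longrightarrow> (g * s + i div s) * s + j div s < x \<or>
        (g * s + i div s) * s + j div s = x \<and> (i mod s) * s + j mod s < y \<Longrightarrow>
        common_in_group i j g \<Longrightarrow> g < b"
  using assms unfolding grouped_def by meson

lemma prepared_iwrite [simp]:
  "a > 6 \<Longrightarrow> prepared x (iwrite a i v \<sigma>) = prepared x \<sigma>" "prepared x (iwrite 3 4 v \<sigma>) = prepared x \<sigma>"
  by (auto simp: prepared_def)

lemma prepared_counter: "prepared x \<sigma> \<Longrightarrow> imem \<sigma> 3 3 = int x"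
  by (simp add: prepared_def)

lemma fresh_iwrite [simp]: "a < 8 \<Longrightarrow> fresh x (iwrite a i v \<sigma>) = fresh x \<sigma>"
  by (auto simp: fresh_def)

lemma loaded_iwrite [simp]: "a < 8 \<Longrightarrow> loaded x g I J y (iwrite a i v \<sigma>) = loaded x g I J y \<sigma>"
  by (auto simp: loaded_def)

lemma fresh_iwrite_cell [simp]:
  "x < K \<Longrightarrow> fresh (Suc x) (iwrite a (i * int K + int x) v \<sigma>) = fresh (Suc x) \<sigma>"
proof -
  assume "x < K"
  then have "j \<noteq> i * int K + int x" if "j mod int K \<ge> int (Suc x)" for j
    using that by auto
  then show ?thesis unfolding fresh_def by auto
qed

text \<open>Both invariants look at arrays below 8 and the real memory only, and thus survive a
  simulated run.\<close>

lemma cong_low_arrays: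
  assumes "\<forall>a<8. imem \<sigma>' a = imem \<sigma> a" "rmem \<sigma>' = rmem \<sigma>"
  shows "prepared x \<sigma>' = prepared x \<sigma>" "grouped x y \<sigma>' = grouped x y \<sigma>"
  using assms by (simp_all add: prepared_def grouped_def holds_graph_def holds_scalars_def
    holds_order_def holds_columns_def)

lemma block_index:
  assumes "y < N"
  obtains a b where "a < s" "b < s" "y = a * s + b" "int y div int s = int a" "int y mod int s = int b"
    "y div s = a" "y mod s = b"
proof
  have "s > 0" using assms by (cases s) (auto simp: N_def)
  then show "y div s < s" "y mod s < s" using assms by (simp_all add: less_mult_imp_div_less N_def)
qed (simp_all add: zdiv_int zmod_int)

text \<open>These are the digits of x in base s; x has three of them since K = s^3.\<close>

lemma product_index:
  assumes "x < K"
  obtains g I J where "g < s" "I < s" "J < s" "x = (g * s + I) * s + J" "int x div int N = int g"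
    "(int x div int s) mod int s = int I" "int x mod int s = int J"
proof
  have "s > 0" using assms by (cases s) (auto simp: K_def)
  then show "x div N < s" "(x div s) mod s < s" "x mod s < s"
    using assms by (simp_all add: less_mult_imp_div_less K_def mult.commute)
  have "x div N = x div s div s" by (simp add: N_def div_mult2_eq)
  then show "x = (x div N * s + (x div s) mod s) * s + x mod s" by simp
qed (simp_all add: zdiv_int zmod_int)

lemma load_blocks_correct:
  assumes x: "x < K" "g < s" "I < s" "J < s" "int x div int N = int g"
      "(int x div int s) mod int s = int I" "int x mod int s = int J"
    and pre: "prepared x \<sigma>" "grouped x 0 \<sigma>" "fresh x \<sigma>"
  shows "achieves B load_blocks \<sigma> (7 * N + 5)
    (\<lambda>\<sigma>. prepared x \<sigma> \<and> grouped x 0 \<sigma> \<and> fresh (Suc x) \<sigma> \<and> loaded x g I J N \<sigma>)"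
  unfolding load_blocks_def Let_def
proof (rule achieves_IWrite_Seq[where U = "7 * N + 3"])
  have K0: "K > 0" using x by simp
  have sB: "int s \<le> B" by (rule B_ge(1)) (rule s_le_n)
  have B1: "1 \<le> B" using sB x by simp
  show "\<bar>ival (scalar 0) \<sigma>\<bar> \<le> B" using pre sB by (simp add: prepared_def holds_scalars_def)
  have cell: "ival (cell_of_run i) \<sigma> = ival i \<sigma> * int K + int x" if "prepared x \<sigma>" for i \<sigma>
    using that by (simp add: cell_of_run_def prepared_def holds_scalars_def)
  have val0: "ival (scalar 0) \<sigma> = int s" using pre by (simp add: prepared_def holds_scalars_def)
  let ?a = "IDiv (scalar 4) (scalar 0)" and ?b = "IMod (scalar 4) (scalar 0)"
  let ?i = "IMod (IDiv (scalar 3) (scalar 0)) (scalar 0)" and ?j = "IMod (scalar 3) (scalar 0)"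
  let ?entry = "\<lambda>i a c. IRead 6 (IAdd (IMul (IAdd (IMul i (scalar 0)) a) (scalar 5))
            (IAdd (IMul group_exp (scalar 0)) c))"
  let ?I = "\<lambda>y \<sigma>. prepared x \<sigma> \<and> grouped x 0 \<sigma> \<and> fresh (Suc x) \<sigma> \<and> loaded x g I J y \<sigma> \<and> imem \<sigma> 3 4 = int y"
  show "achieves B (For 4 (scalar 5)
          (Seq (IWrite 9 (cell_of_run (scalar 4)) (?entry ?i ?a ?b))
               (IWrite 11 (cell_of_run (scalar 4)) (?entry ?j ?b ?a))))
     (iwrite 8 (ival (cell_of_run (IConst 0)) \<sigma>) (ival (scalar 0) \<sigma>) \<sigma>) (7 * N + 3)
     (\<lambda>\<sigma>. prepared x \<sigma> \<and> grouped x 0 \<sigma> \<and> fresh (Suc x) \<sigma> \<and> loaded x g I J N \<sigma>)"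
  proof (rule achieves_For[where N = N and T = 3 and Inv = ?I])
    have "fresh (Suc x) \<sigma>" using pre(3) by (simp add: fresh_def)
    moreover have "imem \<sigma> a (i * int K + int x) = 0" if "a \<ge> 8" for a i
      using pre(3) that x(1) by (simp add: fresh_def)
    then have "loaded x g I J 0 (iwrite 8 (0 * int K + int x) (int s) \<sigma>)"
      using K0 by (simp add: loaded_def)
    moreover have "fresh (Suc x) (iwrite 8 (0 * int K + int x) (int s) \<sigma>)"
      using calculation(1) x(1) by (simp only: fresh_iwrite_cell)
    ultimately show "?I 0 (iwrite 3 4 0 (iwrite 8 (ival (cell_of_run (IConst 0)) \<sigma>) (ival (scalar 0) \<sigma>) \<sigma>))"
      using pre cell[OF pre(1), of "IConst 0"] val0 by simp
    show "imem \<sigma> 3 4 = int y \<and> ival (scalar 5) \<sigma> = int N" if "?I y \<sigma>" for y \<sigma>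
      using that by (simp add: prepared_def holds_scalars_def)
    show "int N \<le> B" by (rule B_ge(4)) simp
    show "N * (3 + 4) + 3 \<le> 7 * N + 3" by simp
    fix y \<sigma> assume y: "y < N" and inv: "?I y \<sigma>"
    obtain a b where ab: "a < s" "b < s" "y = a * s + b" "int y div int s = int a" "int y mod int s = int b"
      "y div s = a" "y mod s = b" using block_index[OF y] .
    have lt: "I * s + a < N" "J * s + b < N" "g * s + b < N" "g * s + a < N"
      unfolding N_def using x ab by (auto intro: row_major_less)
    \<comment> \<open>The second entry is evaluated after the first write; that write goes to array
      9, which the expression does not read.\<close>
    have val: "ival (?entry ?i ?a ?b) \<sigma> = of_bool (rank_adjacent (I * s + a) (g * s + b))"
      "ival (?entry ?j ?b ?a) \<tau> = of_bool (rank_adjacent (J * s + b) (g * s + a))"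
      if "\<tau> = iwrite 9 k v \<sigma>" for k v \<tau>
    proof -
      have "imem \<sigma> 6 (int (I * s + a) * int N + int (g * s + b)) = of_bool (rank_adjacent (I * s + a) (g * s + b))"
        "imem \<sigma> 6 (int (J * s + b) * int N + int (g * s + a)) = of_bool (rank_adjacent (J * s + b) (g * s + a))"
        using inv lt by (simp_all only: prepared_def holds_columns_def)
      then show "ival (?entry ?i ?a ?b) \<sigma> = of_bool (rank_adjacent (I * s + a) (g * s + b))"
        "ival (?entry ?j ?b ?a) \<tau> = of_bool (rank_adjacent (J * s + b) (g * s + a))"
        using inv ab x that by (simp_all add: prepared_def holds_scalars_def)
    qed
    let ?\<sigma>1 = "iwrite 9 (int y * int K + int x) (of_bool (rank_adjacent (I * s + a) (g * s + b))) \<sigma>"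
    let ?\<sigma>2 = "iwrite 11 (int y * int K + int x) (of_bool (rank_adjacent (J * s + b) (g * s + a))) ?\<sigma>1"
    have c: "ival (cell_of_run (scalar 4)) \<sigma> = int y * int K + int x"
      "ival (cell_of_run (scalar 4)) ?\<sigma>1 = int y * int K + int x"
      using inv cell by simp_all
    have "loaded x g I J (Suc y) ?\<sigma>2"
      unfolding loaded_def
    proof (intro allI impI)
      fix a' :: nat and i :: int assume a': "8 \<le> a'"
      have cell_eq: "i * int K + int x = int y * int K + int x \<longleftrightarrow> i = int y" using K0 by simp
      have old: "imem \<sigma> a' (i * int K + int x) =
         (if a' = 8 then (if i = 0 then int s else 0)
          else if a' = 9 then of_bool (0 \<le> i \<and> i < int y \<and>
            rank_adjacent (I * s + nat i div s) (g * s + nat i mod s))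
          else if a' = 11 then of_bool (0 \<le> i \<and> i < int y \<and>
            rank_adjacent (J * s + nat i mod s) (g * s + nat i div s))
          else 0)" using inv a' unfolding loaded_def by blast
      show "imem ?\<sigma>2 a' (i * int K + int x) =
         (if a' = 8 then (if i = 0 then int s else 0)
          else if a' = 9 then of_bool (0 \<le> i \<and> i < int (Suc y) \<and>
            rank_adjacent (I * s + nat i div s) (g * s + nat i mod s))
          else if a' = 11 then of_bool (0 \<le> i \<and> i < int (Suc y) \<and>
            rank_adjacent (J * s + nat i mod s) (g * s + nat i div s))
          else 0)"
      proof (cases "i = int y")
        case True
        show ?thesis using old ab(6,7) unfolding True by auto
      next
        case False
        then have "imem ?\<sigma>2 a' (i * int K + int x) = imem \<sigma> a' (i * int K + int x)"
          using cell_eq by simp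
        moreover have "i < int (Suc y) \<longleftrightarrow> i < int y" using False by auto
        ultimately show ?thesis using old by simp
      qed
    qed
    then have goal: "imem ?\<sigma>2 3 4 = int y \<and> ?I (Suc y) (iwrite 3 4 (int (Suc y)) ?\<sigma>2)"
      using inv x(1) by simp
    show "achieves B (Seq (IWrite 9 (cell_of_run (scalar 4)) (?entry ?i ?a ?b))
               (IWrite 11 (cell_of_run (scalar 4)) (?entry ?j ?b ?a))) \<sigma> 3
        (\<lambda>\<sigma>'. imem \<sigma>' 3 4 = int y \<and> ?I (Suc y) (iwrite 3 4 (int (Suc y)) \<sigma>'))"
    proof (rule achieves_IWrite_Seq[where U = 1])
      show "\<bar>ival (?entry ?i ?a ?b) \<sigma>\<bar> \<le> B" unfolding val(1)[OF refl] using B1 by simp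
      show "achieves B (IWrite 11 (cell_of_run (scalar 4)) (?entry ?j ?b ?a))
        (iwrite 9 (ival (cell_of_run (scalar 4)) \<sigma>) (ival (?entry ?i ?a ?b) \<sigma>) \<sigma>) 1
        (\<lambda>\<sigma>'. imem \<sigma>' 3 4 = int y \<and> ?I (Suc y) (iwrite 3 4 (int (Suc y)) \<sigma>'))"
        unfolding val(1)[OF refl] c(1)
      proof (rule achieves_IWrite)
        show "\<bar>ival (?entry ?j ?b ?a) ?\<sigma>1\<bar> \<le> B" unfolding val(2)[OF refl] using B1 by simp
      qed (simp, unfold val(2)[OF refl] c(2), rule goal)
    qed simp
  qed simp
qed simp

text \<open>An entry of the product counts the common neighbours in group g. The count is at most s
  < m, so the simulated entry is the count itself, and it is positive iff there is such a
  neighbour.\<close>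

lemma sim_com_correct:
  assumes x: "x < K" "g < s" "I < s" "J < s"
    and pre: "prepared x \<sigma>" "grouped x 0 \<sigma>" "fresh (Suc x) \<sigma>" "loaded x g I J N \<sigma>"
  shows "achieves B (sim_com D M) \<sigma> TM (\<lambda>\<sigma>. prepared x \<sigma> \<and> grouped x 0 \<sigma> \<and> fresh (Suc x) \<sigma> \<and>
    (\<forall>a<s. \<forall>b<s. 1 \<le> imem \<sigma> 13 (int (a * s + b) * int K + int x) \<longleftrightarrow>
       common_in_group (I * s + a) (J * s + b) g))"
proof -
  have s0: "s > 0" using x by simp
  then have m1: "int s < m" using D_pos mult_mono[of 1 D "int s" "int s"] by (simp add: m_def)
  interpret simulation D m "int s" "int K" "int x" \<sigma>
    by unfold_locales (rule m_def, use x pre m1 in \<open>simp_all add: prepared_def holds_scalars_def\<close>)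
  define X where "X = mat s s (\<lambda>(a, c). of_bool (rank_adjacent (I * s + a) (g * s + c)) :: real)"
  define Y where "Y = mat s s (\<lambda>(c, b). of_bool (rank_adjacent (J * s + b) (g * s + c)) :: real)"
  have XY: "X \<in> carrier_mat s s" "Y \<in> carrier_mat s s" by (simp_all add: X_def Y_def)
  obtain t \<tau> where t: "exec BM M (matrix_input s X Y) t \<tau>" "t \<le> TM" "matrix_output s (X * Y) \<tau>"
    using M_correct[OF s0 XY] by blast
  have rep: "represents \<sigma> (matrix_input s X Y)"
    unfolding represents_def
  proof (intro conjI allI impI)
    fix a :: nat and i :: int
    have "2 * a + 8 \<noteq> 9 \<and> 2 * a + 8 \<noteq> 11" by presburger
    then show "imem \<sigma> (2 * a + 8) (i * int K + int x) = imem (matrix_input s X Y) a i"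
      using pre(4) by (auto simp: loaded_def matrix_input_def)
    have nat_less: "nat i div s < s" "nat i mod s < s" if "0 \<le> i" "i < int (s * s)"
      using that s0 by (simp_all add: less_mult_imp_div_less nat_less_iff)
    have *: "imem \<sigma> (2 * a + 9) (i * int K + int x) =
        (if a = 0 then of_bool (0 \<le> i \<and> i < int N \<and> rank_adjacent (I * s + nat i div s) (g * s + nat i mod s))
         else if a = 1 then of_bool (0 \<le> i \<and> i < int N \<and> rank_adjacent (J * s + nat i mod s) (g * s + nat i div s))
         else 0)"
    proof -
      have "2 * a + 9 \<noteq> 8" "2 * a + 9 = 9 \<longleftrightarrow> a = 0" "2 * a + 9 = 11 \<longleftrightarrow> a = 1" by presburger+
      then show ?thesis using pre(4) unfolding loaded_def by simp
    qed
    \<comment> \<open>Zeros and ones represent themselves modulo m.\<close>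
    have "rmem (matrix_input s X Y) a i = of_int (imem \<sigma> (2 * a + 9) (i * int K + int x))"
      unfolding * using nat_less by (auto simp: matrix_input_def X_def Y_def N_def)
    moreover have "0 \<le> imem \<sigma> (2 * a + 9) (i * int K + int x)" "imem \<sigma> (2 * a + 9) (i * int K + int x) < m"
      unfolding * using m1 s0 by auto
    ultimately show "residue D m (rmem (matrix_input s X Y) a i) (imem \<sigma> (2 * a + 9) (i * int K + int x))"
      using residue_of_int by simp
  qed simp_all
  from exec_sim_com[OF t(1) M rep B(4,3)] obtain \<sigma>' where
    \<sigma>': "exec B (sim_com D M) \<sigma> t \<sigma>'" "represents \<sigma>' \<tau>" by blast
  have low: "\<forall>a<8. imem \<sigma>' a = imem \<sigma> a" "rmem \<sigma>' = rmem \<sigma>"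
    using \<sigma>'(2) by (simp_all add: represents_def)
  have "fresh (Suc x) \<sigma>'"
    using \<sigma>'(2) pre(3) by (simp add: represents_def fresh_def)
  moreover have "1 \<le> imem \<sigma>' 13 (int (a * s + b) * int K + int x) \<longleftrightarrow>
       common_in_group (I * s + a) (J * s + b) g" if ab: "a < s" "b < s" for a b
  proof -
    let ?S = "{c. c < s \<and> rank_adjacent (I * s + a) (g * s + c) \<and> rank_adjacent (J * s + b) (g * s + c)}"
    have "rmem \<tau> 2 (int (a * s + b)) = (X * Y) $$ (a, b)"
      using t(3) ab by (simp add: matrix_output_def)
    also have "\<dots> = (\<Sum>c<s. of_bool (rank_adjacent (I * s + a) (g * s + c)) *
        of_bool (rank_adjacent (J * s + b) (g * s + c)))"
      using ab XY by (simp add: X_def Y_def scalar_prod_def lessThan_atLeast0)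
    also have "\<dots> = (\<Sum>c<s. of_bool (c \<in> ?S))" by (intro sum.cong) auto
    also have "\<dots> = real (card ?S)"
    proof -
      have "{..<s} \<inter> {c. c \<in> ?S} = ?S" by auto
      then show ?thesis by (simp only: sum_of_bool_eq finite_lessThan)
    qed
    finally have val: "rmem \<tau> 2 (int (a * s + b)) = of_int (int (card ?S))" by simp
    have "residue D m (rmem \<tau> 2 (int (a * s + b))) (imem \<sigma>' 13 (int (a * s + b) * int K + int x))"
    proof -
      have "residue D m (rmem \<tau> 2 (int (a * s + b))) (imem \<sigma>' (2 * 2 + 9) (int (a * s + b) * int K + int x))"
        using \<sigma>'(2) unfolding represents_def by blast
      then show ?thesis by simp
    qed
    moreover have "card ?S \<le> card {..<s}" by (intro card_mono) auto
    then have "int (card ?S) < m" using m1 by simp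
    ultimately have "imem \<sigma>' 13 (int (a * s + b) * int K + int x) = int (card ?S)"
      using residue_unique[OF _ modulus(1)] unfolding val by simp
    moreover have "card ?S > 0 \<longleftrightarrow> common_in_group (I * s + a) (J * s + b) g"
      by (auto simp: card_gt_0_iff common_in_group_def s_def)
    ultimately show ?thesis by (simp add: Suc_le_eq)
  qed
  ultimately show ?thesis
    unfolding achieves_def using \<sigma>'(1) t(2) pre(1,2) cong_low_arrays[OF low] by blast
qed

lemma update_groups_correct:
  assumes x: "x < K" "g < s" "I < s" "J < s" "x = (g * s + I) * s + J" "int x div int N = int g"
      "(int x div int s) mod int s = int I" "int x mod int s = int J"
    and pre: "prepared x \<sigma>" "grouped x 0 \<sigma>" "fresh (Suc x) \<sigma>"
      "\<forall>a<s. \<forall>b<s. 1 \<le> imem \<sigma> 13 (int (a * s + b) * int K + int x) \<longleftrightarrow>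
        common_in_group (I * s + a) (J * s + b) g"
  shows "achieves B update_groups \<sigma> (6 * N + 3)
    (\<lambda>\<sigma>. prepared x \<sigma> \<and> grouped (Suc x) 0 \<sigma> \<and> fresh (Suc x) \<sigma>)"
  unfolding update_groups_def Let_def
proof (rule achieves_For[where N = N and T = 2])
  let ?P = "\<lambda>\<sigma>. \<forall>a<s. \<forall>b<s. 1 \<le> imem \<sigma> 13 (int (a * s + b) * int K + int x) \<longleftrightarrow>
        common_in_group (I * s + a) (J * s + b) g"
  let ?I = "\<lambda>y \<sigma>. prepared x \<sigma> \<and> grouped x y \<sigma> \<and> fresh (Suc x) \<sigma> \<and> ?P \<sigma> \<and> imem \<sigma> 3 4 = int y"
  let ?row = "IAdd (IMul (IMod (IDiv (scalar 3) (scalar 0)) (scalar 0)) (scalar 0)) (IDiv (scalar 4) (scalar 0))"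
  let ?col = "IAdd (IMul (IMod (scalar 3) (scalar 0)) (scalar 0)) (IMod (scalar 4) (scalar 0))"
  show "?I 0 (iwrite 3 4 0 \<sigma>)" using pre by simp
  show "imem \<sigma> 3 4 = int y \<and> ival (scalar 5) \<sigma> = int N" if "?I y \<sigma>" for y \<sigma>
    using that by (simp add: prepared_def holds_scalars_def)
  show "int N \<le> B" by (rule B_ge(4)) simp
  show "N * (2 + 4) + 3 \<le> 6 * N + 3" by simp
  show "prepared x \<sigma> \<and> grouped (Suc x) 0 \<sigma> \<and> fresh (Suc x) \<sigma>" if I: "?I N \<sigma>" for \<sigma>
  proof -
    \<comment> \<open>Every entry position is below N, so with y = N the second alternative in
      \<open>grouped\<close> covers all of product x, which is
      \<open>grouped (Suc x) 0\<close>.\<close>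
    have "(i mod s) * s + j mod s < N" for i j
      unfolding N_def using x by (intro row_major_less) auto
    then have "grouped (Suc x) 0 \<sigma>" using I by (simp add: grouped_def less_Suc_eq)
    then show ?thesis using I by simp
  qed
  fix y \<sigma> assume y: "y < N" and inv: "?I y \<sigma>"
  obtain a b where ab: "a < s" "b < s" "y = a * s + b" "int y div int s = int a" "int y mod int s = int b"
      "y div s = a" "y mod s = b" using block_index[OF y] .
  have lt: "I * s + a < N" "J * s + b < N"
    unfolding N_def using x ab by (auto intro: row_major_less)
  have pos: "ival (IAdd (IMul ?row (scalar 5)) ?col) \<sigma> = int (I * s + a) * int N + int (J * s + b)"
    using inv x ab by (simp add: prepared_def holds_scalars_def)
  have val: "ival (IAdd group_exp (IConst 1)) \<sigma> = int (Suc g)"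
    using inv x by (simp add: prepared_def holds_scalars_def)
  have test: "bval (ILe (IConst 1) (IRead 13 (cell_of_run (scalar 4)))) \<sigma> \<longleftrightarrow>
      common_in_group (I * s + a) (J * s + b) g"
  proof -
    have "ival (cell_of_run (scalar 4)) \<sigma> = int (a * s + b) * int K + int x"
      using inv ab(3) by (simp add: cell_of_run_def prepared_def holds_scalars_def)
    then show ?thesis using inv ab by simp
  qed
  let ?now = "\<lambda>y i j g'. (g' * s + i div s) * s + j div s < x \<or>
        (g' * s + i div s) * s + j div s = x \<and> (i mod s) * s + j mod s < y"
  have s0: "s > 0" using x by simp
  \<comment> \<open>The base s digits of x and y determine i and j, so round y brings news about one
    pair of vertices only.\<close>
  have now_other: "?now (Suc y) i j g' \<longleftrightarrow> ?now y i j g'"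
    if "i < N" "j < N" "\<not> (i = I * s + a \<and> j = J * s + b)" for i j g'
  proof -
    have "i div s = I \<and> j div s = J \<and> i mod s = a \<and> j mod s = b"
      if *: "(g' * s + i div s) * s + j div s = x" "(i mod s) * s + j mod s = y"
    proof -
      have d: "i div s < s" "j div s < s" "i mod s < s" "j mod s < s"
        using \<open>i < N\<close> \<open>j < N\<close> s0 by (simp_all add: N_def less_mult_imp_div_less)
      have "(g' * s + i div s) * s + j div s = (g * s + I) * s + J" using *(1) x(5) by simp
      then have "g' * s + i div s = g * s + I" "j div s = J" using row_major_inj[OF d(2) x(4)] by blast+
      moreover have "i mod s = a \<and> j mod s = b"
        using *(2) row_major_inj[OF d(4) ab(2), of "i mod s" a] ab(3) by simp
      ultimately show ?thesis using row_major_inj[OF d(1) x(3)] by blast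
    qed
    then have "i = I * s + a \<and> j = J * s + b"
      if "(g' * s + i div s) * s + j div s = x" "(i mod s) * s + j mod s = y"
      using div_mult_mod_eq[of i s] div_mult_mod_eq[of j s] that by metis
    then have "\<not> ((g' * s + i div s) * s + j div s = x \<and> (i mod s) * s + j mod s = y)"
      using that(3) by blast
    then show ?thesis by (auto simp: less_Suc_eq)
  qed
  \<comment> \<open>The groups treated so far for this pair are at most g, because the group is the
    leading digit; hence the new value g + 1 exceeds them all.\<close>
  have now_le: "g' \<le> g" if "?now (Suc y) (I * s + a) (J * s + b) g'" for g'
  proof (rule ccontr)
    assume "\<not> g' \<le> g"
    have "(I * s + a) div s = I" "(J * s + b) div s = J" using ab by simp_all
    then have "(g' * s + I) * s + J \<le> (g * s + I) * s + J" using that x(5) by auto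
    then show False using \<open>\<not> g' \<le> g\<close> s0 by simp
  qed
  \<comment> \<open>Needed if the entry is 0 and nothing is written: groups other than g were
    treated in earlier products, so the old value already accounts for them.\<close>
  have now_old: "?now y (I * s + a) (J * s + b) g'" if "?now (Suc y) (I * s + a) (J * s + b) g'" "g' \<noteq> g" for g'
  proof -
    have *: "(I * s + a) div s = I" "(J * s + b) div s = J" using ab by simp_all
    have "(g' * s + I) * s + J < x"
    proof -
      have "g' < g" using now_le[OF that(1)] that(2) by simp
      then have "(g' * s + I) * s < (g * s + I) * s" using s0 by simp
      then show ?thesis using x(5) by simp
    qed
    then show ?thesis using * by simp
  qed
  show "achieves B (Cond (ILe (IConst 1) (IRead 13 (cell_of_run (scalar 4))))
      (IWrite 7 (IAdd (IMul ?row (scalar 5)) ?col) (IAdd group_exp (IConst 1))) Skip) \<sigma> 2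
      (\<lambda>\<sigma>'. imem \<sigma>' 3 4 = int y \<and> ?I (Suc y) (iwrite 3 4 (int (Suc y)) \<sigma>'))"
  proof (rule achieves_Cond[where T = 1])
    assume "bval (ILe (IConst 1) (IRead 13 (cell_of_run (scalar 4)))) \<sigma>"
    then have com: "common_in_group (I * s + a) (J * s + b) g" using test by blast
    let ?\<sigma>1 = "iwrite 7 (int (I * s + a) * int N + int (J * s + b)) (int (Suc g)) \<sigma>"
    have "grouped x (Suc y) ?\<sigma>1"
      unfolding grouped_def
    proof (intro allI impI)
      fix i j assume ij: "i < N" "j < N"
      show "\<exists>b\<le>s. imem ?\<sigma>1 7 (int i * int N + int j) = int b \<and> (b > 0 \<longrightarrow> common_in_group i j (b - 1)) \<and>
         (\<forall>g<s. ?now (Suc y) i j g \<longrightarrow> common_in_group i j g \<longrightarrow> g < b)"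
      proof (cases "i = I * s + a \<and> j = J * s + b")
        case True
        then have "imem ?\<sigma>1 7 (int i * int N + int j) = int (Suc g)" by simp
        moreover have "g' < Suc g" if "?now (Suc y) i j g'" for g'
          using now_le[of g'] that True by simp
        ultimately show ?thesis using com True x(2) by (intro exI[of _ "Suc g"]) simp
      next
        case False
        have "int i * int N + int j \<noteq> int (I * s + a) * int N + int (J * s + b)"
          using row_major_inj_int[OF ij(2) lt(2), of i "I * s + a"] False by blast
        then have same: "imem ?\<sigma>1 7 (int i * int N + int j) = imem \<sigma> 7 (int i * int N + int j)" by simp
        from inv have "grouped x y \<sigma>" by blast
        from groupedE[OF this ij] obtain b where b: "b \<le> s" "imem \<sigma> 7 (int i * int N + int j) = int b"
          "b > 0 \<Longrightarrow> common_in_group i j (b - 1)"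
          "\<And>g. g < s \<Longrightarrow> ?now y i j g \<Longrightarrow> common_in_group i j g \<Longrightarrow> g < b" by metis
        show ?thesis unfolding same now_other[OF ij False] using b by blast
      qed
    qed
    then have post: "imem ?\<sigma>1 3 4 = int y \<and> ?I (Suc y) (iwrite 3 4 (int (Suc y)) ?\<sigma>1)" using inv by simp
    have gB: "int (Suc g) \<le> B" using x(2) s_le_n by (intro B_ge(1)) simp
    show "achieves B (IWrite 7 (IAdd (IMul ?row (scalar 5)) ?col) (IAdd group_exp (IConst 1))) \<sigma> 1
      (\<lambda>\<sigma>'. imem \<sigma>' 3 4 = int y \<and> ?I (Suc y) (iwrite 3 4 (int (Suc y)) \<sigma>'))"
    proof (rule achieves_IWrite)
      show "\<bar>ival (IAdd group_exp (IConst 1)) \<sigma>\<bar> \<le> B" unfolding val using gB by simp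
    qed (simp, unfold pos val, rule post)
  next
    assume "\<not> bval (ILe (IConst 1) (IRead 13 (cell_of_run (scalar 4)))) \<sigma>"
    then have com: "\<not> common_in_group (I * s + a) (J * s + b) g" using test by blast
    have "grouped x (Suc y) \<sigma>"
      unfolding grouped_def
    proof (intro allI impI)
      fix i j assume ij: "i < N" "j < N"
      have "?now y i j g'" if "?now (Suc y) i j g'" "common_in_group i j g'" for g'
      proof (cases "i = I * s + a \<and> j = J * s + b")
        case True
        then have "g' \<noteq> g" using com that(2) by auto
        then show ?thesis using now_old[of g'] that(1) True by simp
      next
        case False
        then show ?thesis using now_other[OF ij False] that(1) by simp
      qed
      note old = this
      from inv have "grouped x y \<sigma>" by blast
      from groupedE[OF this ij] obtain b where b: "b \<le> s" "imem \<sigma> 7 (int i * int N + int j) = int b"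
        "b > 0 \<Longrightarrow> common_in_group i j (b - 1)"
        "\<And>g. g < s \<Longrightarrow> ?now y i j g \<Longrightarrow> common_in_group i j g \<Longrightarrow> g < b" by metis
      then have "g < b" if "g < s" "?now (Suc y) i j g" "common_in_group i j g" for g
        using old that by blast
      with b(1-3) show "\<exists>b\<le>s. imem \<sigma> 7 (int i * int N + int j) = int b \<and> (b > 0 \<longrightarrow> common_in_group i j (b - 1)) \<and>
         (\<forall>g<s. ?now (Suc y) i j g \<longrightarrow> common_in_group i j g \<longrightarrow> g < b)"
        by blast
    qed
    then show "achieves B Skip \<sigma> 1
      (\<lambda>\<sigma>'. imem \<sigma>' 3 4 = int y \<and> ?I (Suc y) (iwrite 3 4 (int (Suc y)) \<sigma>'))"
      using inv by (intro achieves_Skip) simp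
  qed simp
qed

lemma find_groups_correct:
  assumes "holds_graph \<sigma>" "blank 7 \<sigma>" "holds_scalars \<sigma>" "holds_order \<sigma>" "holds_columns \<sigma>"
  shows "achieves B (find_groups D M) \<sigma> (K * (13 * N + TM + 14) + 3)
    (\<lambda>\<sigma>. prepared K \<sigma> \<and> grouped K 0 \<sigma>)"
  unfolding find_groups_def
proof (rule achieves_For[where N = K and T = "13 * N + TM + 10" and
    Inv = "\<lambda>x \<sigma>. prepared x \<sigma> \<and> grouped x 0 \<sigma> \<and> fresh x \<sigma>"])
  let ?I = "\<lambda>x \<sigma>. prepared x \<sigma> \<and> grouped x 0 \<sigma> \<and> fresh x \<sigma>"
  have prep: "prepared x (iwrite 3 3 (int x) \<sigma>)" if "prepared x' \<sigma>" for x x' \<sigma>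
    using that by (simp add: prepared_def)
  show "?I 0 (iwrite 3 3 0 \<sigma>)"
    using assms by (auto simp: prepared_def grouped_def fresh_def blank_def)
  show "imem \<sigma> 3 3 = int x \<and> ival (scalar 2) \<sigma> = int K" if "?I x \<sigma>" for x \<sigma>
    using that by (simp add: prepared_def holds_scalars_def)
  show "int K \<le> B" by (rule B_ge(5)) simp
  show "K * (13 * N + TM + 10 + 4) + 3 \<le> K * (13 * N + TM + 14) + 3" by simp
  show "prepared K \<sigma> \<and> grouped K 0 \<sigma>" if "?I K \<sigma>" for \<sigma> using that by simp
  fix x \<sigma> assume x: "x < K" and inv: "?I x \<sigma>"
  obtain g I J where gIJ: "g < s" "I < s" "J < s" "x = (g * s + I) * s + J" "int x div int N = int g"
    "(int x div int s) mod int s = int I" "int x mod int s = int J" using product_index[OF x] .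
  \<comment> \<open>The bound adds 7N + 5 for loading, TM for the product, 6N + 3 for reading it off
    and 2 for sequencing.\<close>
  show "achieves B (Seq load_blocks (Seq (sim_com D M) update_groups)) \<sigma> (13 * N + TM + 10)
    (\<lambda>\<sigma>'. imem \<sigma>' 3 3 = int x \<and> ?I (Suc x) (iwrite 3 3 (int (Suc x)) \<sigma>'))"
  proof (rule achieves_Seq)
    show "achieves B load_blocks \<sigma> (7 * N + 5)
      (\<lambda>\<sigma>. prepared x \<sigma> \<and> grouped x 0 \<sigma> \<and> fresh (Suc x) \<sigma> \<and> loaded x g I J N \<sigma>)"
      using load_blocks_correct[OF x gIJ(1-3,5-7)] inv by blast
    fix \<sigma> assume 1: "prepared x \<sigma> \<and> grouped x 0 \<sigma> \<and> fresh (Suc x) \<sigma> \<and> loaded x g I J N \<sigma>"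
    show "achieves B (Seq (sim_com D M) update_groups) \<sigma> (TM + (6 * N + 3) + 1)
      (\<lambda>\<sigma>'. imem \<sigma>' 3 3 = int x \<and> ?I (Suc x) (iwrite 3 3 (int (Suc x)) \<sigma>'))"
    proof (rule achieves_Seq)
      show "achieves B (sim_com D M) \<sigma> TM (\<lambda>\<sigma>. prepared x \<sigma> \<and> grouped x 0 \<sigma> \<and> fresh (Suc x) \<sigma> \<and>
        (\<forall>a<s. \<forall>b<s. 1 \<le> imem \<sigma> 13 (int (a * s + b) * int K + int x) \<longleftrightarrow>
          common_in_group (I * s + a) (J * s + b) g))"
        using sim_com_correct[OF x gIJ(1-3)] 1 by blast
      fix \<sigma> assume 2: "prepared x \<sigma> \<and> grouped x 0 \<sigma> \<and> fresh (Suc x) \<sigma> \<and>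
        (\<forall>a<s. \<forall>b<s. 1 \<le> imem \<sigma> 13 (int (a * s + b) * int K + int x) \<longleftrightarrow>
          common_in_group (I * s + a) (J * s + b) g)"
      then have "achieves B update_groups \<sigma> (6 * N + 3)
        (\<lambda>\<sigma>. prepared x \<sigma> \<and> grouped (Suc x) 0 \<sigma> \<and> fresh (Suc x) \<sigma>)"
        using update_groups_correct[OF x gIJ] by blast
      then show "achieves B update_groups \<sigma> (6 * N + 3)
        (\<lambda>\<sigma>'. imem \<sigma>' 3 3 = int x \<and> ?I (Suc x) (iwrite 3 3 (int (Suc x)) \<sigma>'))"
        by (rule achieves_weaken) (auto intro: prep dest: prepared_counter simp del: of_nat_Suc)
    qed simp
  qed simp
qed

section \<open>Scanning the last groups\<close>

text \<open>
  Candidate number \<open>y = (u * n + v) * s + c\<close> consists of \<open>u\<close>, \<open>v\<close> and the vertex at position \<open>c\<close> of the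
  last group \<open>b u v - 1\<close> that contains a common neighbour of \<open>u\<close> and \<open>v\<close>.
\<close>

definition first_vertex :: "nat \<Rightarrow> nat" where
  "first_vertex y = y div s div n"

definition second_vertex :: "nat \<Rightarrow> nat" where
  "second_vertex y = y div s mod n"

definition third_rank :: "(nat \<Rightarrow> nat \<Rightarrow> nat) \<Rightarrow> nat \<Rightarrow> nat" where
  "third_rank b y = (b (first_vertex y) (second_vertex y) - 1) * s + y mod s"

text \<open>Arbitrary if no vertex has this rank, which \<open>candidate\<close> excludes.\<close>

definition third_vertex :: "(nat \<Rightarrow> nat \<Rightarrow> nat) \<Rightarrow> nat \<Rightarrow> nat" where
  "third_vertex b y = inv_into {..<n} rank (third_rank b y)"

text \<open>Positivity of b has to be a condition: with natural subtraction, the value 0 would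
  otherwise select group 0.\<close>

definition candidate :: "(nat \<Rightarrow> nat \<Rightarrow> nat) \<Rightarrow> nat \<Rightarrow> bool" where
  "candidate b y \<longleftrightarrow> {first_vertex y, second_vertex y} \<in> E \<and> b (first_vertex y) (second_vertex y) > 0 \<and>
     rank_adjacent (first_vertex y) (third_rank b y) \<and> rank_adjacent (second_vertex y) (third_rank b y)"

definition candidate_weight :: "(nat \<Rightarrow> nat \<Rightarrow> nat) \<Rightarrow> nat \<Rightarrow> real" where
  "candidate_weight b y = w (first_vertex y) + w (second_vertex y) + w (third_vertex b y)"

definition last_groups :: "(nat \<Rightarrow> nat \<Rightarrow> nat) \<Rightarrow> bool" where
  "last_groups b \<longleftrightarrow> (\<forall>u<n. \<forall>v<n. b u v \<le> s \<and> (b u v > 0 \<longrightarrow> common_in_group u v (b u v - 1)) \<and>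
     (\<forall>g<s. common_in_group u v g \<longrightarrow> g < b u v))"

lemma inv_rank: "z < n \<Longrightarrow> inv_into {..<n} rank (rank z) = z"
  by (rule inv_into_f_f) (auto simp: inj_on_def rank_inj)

text \<open>The two adjacencies provide two neighbours of the same rank; as \<open>rank\<close> is
  injective, both are the third vertex.\<close>

lemma candidate_third:
  assumes "candidate b y"
  shows "third_vertex b y < n" "rank (third_vertex b y) = third_rank b y"
    "{first_vertex y, third_vertex b y} \<in> E" "{second_vertex y, third_vertex b y} \<in> E"
proof -
  obtain z where z: "z < n" "third_rank b y = rank z" "{first_vertex y, z} \<in> E"
    using assms unfolding candidate_def rank_adjacent_def by blast
  obtain z' where z': "z' < n" "third_rank b y = rank z'" "{second_vertex y, z'} \<in> E"
    using assms unfolding candidate_def rank_adjacent_def by blast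
  have "third_vertex b y = z" "third_vertex b y = z'"
    unfolding third_vertex_def using inv_rank[OF z(1)] inv_rank[OF z'(1)] z(2) z'(2) by metis+
  then show "third_vertex b y < n" "rank (third_vertex b y) = third_rank b y"
    "{first_vertex y, third_vertex b y} \<in> E" "{second_vertex y, third_vertex b y} \<in> E"
    using z z' by simp_all
qed

lemma candidate_triangle:
  assumes "candidate b y"
  shows "triangle E {first_vertex y, second_vertex y, third_vertex b y}"
    and "triangle_weight w {first_vertex y, second_vertex y, third_vertex b y} = candidate_weight b y"
proof -
  have e: "{first_vertex y, second_vertex y} \<in> E" using assms by (simp add: candidate_def)
  note e' = candidate_third(3,4)[OF assms]
  have ne: "first_vertex y \<noteq> second_vertex y" "first_vertex y \<noteq> third_vertex b y" "second_vertex y \<noteq> third_vertex b y"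
    using edge_less[OF e] edge_less[OF e'(1)] edge_less[OF e'(2)] by simp_all
  show "triangle E {first_vertex y, second_vertex y, third_vertex b y}"
    unfolding triangle_def using ne e e' by (auto simp: insert_commute)
  show "triangle_weight w {first_vertex y, second_vertex y, third_vertex b y} = candidate_weight b y"
    unfolding triangle_weight_def candidate_weight_def using ne by simp
qed

text \<open>If x lies in the last group with a common neighbour of u and v, it is itself scanned.
  Otherwise all ranks of the last group exceed that of x, so any common neighbour there is at least
  as heavy.\<close>

lemma triangle_candidate:
  assumes b: "last_groups b" and T: "triangle E T"
  shows "\<exists>y<n * n * s. candidate b y \<and> triangle_weight w T \<le> candidate_weight b y"
proof -
  obtain u v x where uvx: "T = {u, v, x}" "u \<noteq> v" "v \<noteq> x" "u \<noteq> x"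
    using T unfolding triangle_def card_3_iff by blast
  have E: "{u, v} \<in> E" "{u, x} \<in> E" "{v, x} \<in> E" using T uvx unfolding triangle_def by auto
  have lt: "u < n" "v < n" "x < n" using edge_less[OF E(1)] edge_less[OF E(2)] by auto
  have s0: "s > 0" using lt n_le_N by (cases s) (auto simp: N_def)
  let ?g = "rank x div s"
  have rx: "rank x < N" using rank_less[OF lt(3)] n_le_N by simp
  then have g: "?g < s" by (simp add: N_def less_mult_imp_div_less)
  have split: "rank x = ?g * s + rank x mod s" by simp
  have adj: "rank_adjacent u (rank x)" "rank_adjacent v (rank x)"
    unfolding rank_adjacent_def using lt E by blast+
  have com': "common_in_group u v ?g"
    unfolding common_in_group_def using adj split s0 s_def by (metis mod_less_divisor)
  have less: "?g < b u v" and pos: "b u v > 0" and com: "common_in_group u v (b u v - 1)"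
  proof -
    have "(b u v > 0 \<longrightarrow> common_in_group u v (b u v - 1)) \<and> (\<forall>g<s. common_in_group u v g \<longrightarrow> g < b u v)"
      using b lt unfolding last_groups_def by blast
    then show "?g < b u v" "b u v > 0" "common_in_group u v (b u v - 1)"
      using com' g by (metis gr_implies_not0 neq0_conv)+
  qed
  have "\<exists>c<s. rank_adjacent u ((b u v - 1) * s + c) \<and> rank_adjacent v ((b u v - 1) * s + c) \<and>
      rank x \<le> (b u v - 1) * s + c"
  proof (cases "b u v - 1 = ?g")
    case True
    then show ?thesis using adj split s0 by (metis mod_less_divisor order_refl)
  next
    case False
    obtain c where c: "c < s" "rank_adjacent u ((b u v - 1) * s + c)" "rank_adjacent v ((b u v - 1) * s + c)"
      using com unfolding common_in_group_def s_def by blast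
    have "?g < b u v - 1" using False less by simp
    then have "?g * s + rank x mod s < (b u v - 1) * s" using s0 by (intro row_major_less) auto
    then have "rank x \<le> (b u v - 1) * s + c" using split by linarith
    then show ?thesis using c by blast
  qed
  then obtain c where c: "c < s" "rank_adjacent u ((b u v - 1) * s + c)" "rank_adjacent v ((b u v - 1) * s + c)"
    "rank x \<le> (b u v - 1) * s + c" by blast
  define y where "y = (u * n + v) * s + c"
  have div: "y div s = u * n + v" "y mod s = c" using c by (simp_all add: y_def)
  have uv: "first_vertex y = u" "second_vertex y = v"
    using lt by (simp_all add: first_vertex_def second_vertex_def div)
  have tr: "third_rank b y = (b u v - 1) * s + c" by (simp add: third_rank_def uv div)
  have cand: "candidate b y" unfolding candidate_def uv tr using E pos c by simp
  have "y < n * n * s" unfolding y_def using lt c(1) by (intro row_major_less)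
  moreover have "w x \<le> w (third_vertex b y)"
    using rank_weight[OF candidate_third(1)[OF cand], of x] candidate_third(2)[OF cand] tr c(4) by simp
  then have "triangle_weight w T \<le> candidate_weight b y"
    unfolding triangle_weight_def candidate_weight_def uv uvx(1) using uvx(2-4) by simp
  ultimately show ?thesis using cand by blast
qed

definition recorded :: "(nat \<Rightarrow> nat \<Rightarrow> nat) \<Rightarrow> nat \<Rightarrow> (int \<Rightarrow> int) \<Rightarrow> bool" where
  "recorded b y out \<longleftrightarrow> out 0 = 0 \<and> (\<forall>t<y. \<not> candidate b t) \<or>
     out 0 = 1 \<and> (\<exists>t<y. candidate b t \<and> out 1 = int (first_vertex t) \<and> out 2 = int (second_vertex t) \<and>
       out 3 = int (third_vertex b t) \<and> (\<forall>t'<y. candidate b t' \<longrightarrow> candidate_weight b t' \<le> candidate_weight b t))"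

lemma recorded_skip:
  assumes "recorded b y out"
    "candidate b y \<Longrightarrow> out 0 = 1 \<and>
      candidate_weight b y \<le> w (nat (out 1)) + w (nat (out 2)) + w (nat (out 3))"
  shows "recorded b (Suc y) out"
proof (cases "candidate b y")
  case True
  with assms obtain t where t: "t < y" "candidate b t" "out 0 = 1" "out 1 = int (first_vertex t)"
    "out 2 = int (second_vertex t)" "out 3 = int (third_vertex b t)"
    "\<forall>t'<y. candidate b t' \<longrightarrow> candidate_weight b t' \<le> candidate_weight b t"
    unfolding recorded_def by auto
  have "candidate_weight b y \<le> candidate_weight b t"
    using assms(2)[OF True] t(4-6) by (simp add: candidate_weight_def)
  then have "\<forall>t'<Suc y. candidate b t' \<longrightarrow> candidate_weight b t' \<le> candidate_weight b t"
    using t(7) by (simp add: less_Suc_eq)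
  then show ?thesis unfolding recorded_def using t(1-6) less_SucI by blast
next
  case False
  have l: "t < Suc y \<longleftrightarrow> t < y \<or> t = y" for t by auto
  from assms(1) False show ?thesis unfolding recorded_def l by metis
qed

lemma recorded_update:
  assumes "recorded b y out" "candidate b y"
    "out 0 = 1 \<Longrightarrow> w (nat (out 1)) + w (nat (out 2)) + w (nat (out 3)) < candidate_weight b y"
    "out' 0 = 1" "out' 1 = int (first_vertex y)" "out' 2 = int (second_vertex y)" "out' 3 = int (third_vertex b y)"
  shows "recorded b (Suc y) out'"
proof -
  have "candidate_weight b t' \<le> candidate_weight b y" if t': "t' < Suc y" "candidate b t'" for t'
  proof (cases "t' = y")
    case False
    with t' have "t' < y" by simp
    with assms(1) t'(2) obtain t where t: "out 0 = 1" "out 1 = int (first_vertex t)"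
      "out 2 = int (second_vertex t)" "out 3 = int (third_vertex b t)"
      "candidate_weight b t' \<le> candidate_weight b t"
      unfolding recorded_def by metis
    have "candidate_weight b t < candidate_weight b y"
      using assms(3)[OF t(1)] t(2-4) by (simp add: candidate_weight_def)
    then show ?thesis using t(5) by simp
  qed simp
  then show ?thesis unfolding recorded_def using assms(2,4-7) by blast
qed

text \<open>If there is a triangle, \<open>triangle_candidate\<close> excludes the first alternative
  of \<open>recorded\<close>; if there is none, \<open>candidate_triangle\<close> excludes the
  second.\<close>

lemma recorded_output:
  assumes "last_groups b" "recorded b (n * n * s) (imem \<sigma> 2)"
  shows "maximum_triangle_output E w \<sigma>"
proof (cases "\<exists>T. triangle E T")
  case True
  then obtain T y where "triangle E T" "y < n * n * s" "candidate b y"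
    using triangle_candidate[OF assms(1)] by blast
  with assms(2) obtain t where t: "candidate b t" "imem \<sigma> 2 0 = 1" "imem \<sigma> 2 1 = int (first_vertex t)"
    "imem \<sigma> 2 2 = int (second_vertex t)" "imem \<sigma> 2 3 = int (third_vertex b t)"
    "\<forall>t'<n * n * s. candidate b t' \<longrightarrow> candidate_weight b t' \<le> candidate_weight b t"
    unfolding recorded_def by metis
  have "maximum_triangle E w {first_vertex t, second_vertex t, third_vertex b t}"
    unfolding maximum_triangle_def
  proof (intro conjI allI impI)
    show "triangle E {first_vertex t, second_vertex t, third_vertex b t}" by (rule candidate_triangle) fact
    fix T' assume "triangle E T'"
    then obtain y where "y < n * n * s" "candidate b y" "triangle_weight w T' \<le> candidate_weight b y"
      using triangle_candidate[OF assms(1)] by blast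
    then show "triangle_weight w T' \<le> triangle_weight w {first_vertex t, second_vertex t, third_vertex b t}"
      unfolding candidate_triangle(2)[OF t(1)] using t(6) by force
  qed
  then show ?thesis unfolding maximum_triangle_output_def using True t(2-5) by auto
next
  case False
  then have "\<not> candidate b t" for t using candidate_triangle(1) by blast
  then show ?thesis using assms(2) False unfolding maximum_triangle_output_def recorded_def by simp
qed

lemma scan_groups_correct:
  assumes pre: "prepared K \<sigma>0" "grouped K 0 \<sigma>0"
  shows "achieves B scan_groups \<sigma>0 (12 * (n * n * s) + 3) (maximum_triangle_output E w)"
  unfolding scan_groups_def Let_def
proof -
  define b where "b u v = nat (imem \<sigma>0 7 (int u * int N + int v))" for u v
  have b: "imem \<sigma>0 7 (int u * int N + int v) = int (b u v)" "b u v \<le> s"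
    "b u v > 0 \<Longrightarrow> common_in_group u v (b u v - 1)"
    "\<And>g. g < s \<Longrightarrow> common_in_group u v g \<Longrightarrow> g < b u v" if "u < n" "v < n" for u v
  proof -
    have uv: "u < N" "v < N" using that n_le_N by simp_all
    obtain c where c: "c \<le> s" "imem \<sigma>0 7 (int u * int N + int v) = int c"
      "c > 0 \<Longrightarrow> common_in_group u v (c - 1)"
      "\<And>g. g < s \<Longrightarrow> (g * s + u div s) * s + v div s < K \<Longrightarrow> common_in_group u v g \<Longrightarrow> g < c"
      using groupedE[OF pre(2) uv] by metis
    \<comment> \<open>All product numbers are below K, so after the last product the values bound
      every group.\<close>
    have "(g * s + u div s) * s + v div s < K" if "g < s" for g
      unfolding K_def N_def using that uv by (intro row_major_less) (simp_all add: N_def less_mult_imp_div_less)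
    then show "imem \<sigma>0 7 (int u * int N + int v) = int (b u v)" "b u v \<le> s"
      "b u v > 0 \<Longrightarrow> common_in_group u v (b u v - 1)"
      "\<And>g. g < s \<Longrightarrow> common_in_group u v g \<Longrightarrow> g < b u v"
      using c by (simp_all add: b_def)
  qed
  then have lg: "last_groups b" unfolding last_groups_def by blast
  let ?u = "IDiv (IDiv (scalar 4) (scalar 0)) size_exp" and ?v = "IMod (IDiv (scalar 4) (scalar 0)) size_exp"
  let ?g = "IRead 7 (IAdd (IMul ?u (scalar 5)) ?v)"
  let ?r = "IAdd (IMul (ISub ?g (IConst 1)) (scalar 0)) (IMod (scalar 4) (scalar 0))"
  let ?x = "IRead 5 ?r"
  let ?out = "\<lambda>k. IRead 2 (IConst k)"
  let ?weight = "\<lambda>u v x. RAdd (RAdd (RRead 0 u) (RRead 0 v)) (RRead 0 x)"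
  let ?test = "BAnd (ILe (IConst 1) (IRead 1 (IDiv (scalar 4) (scalar 0))))
              (BAnd (ILe (IConst 1) ?g)
              (BAnd (ILe (IConst 1) (IRead 6 (IAdd (IMul ?u (scalar 5)) ?r)))
              (BAnd (ILe (IConst 1) (IRead 6 (IAdd (IMul ?v (scalar 5)) ?r)))
                    (BNot (BAnd (ILe (IConst 1) (?out 0))
                      (RLe (?weight ?u ?v ?x) (?weight (?out 1) (?out 2) (?out 3))))))))"
  let ?F = "\<lambda>\<sigma>. holds_graph \<sigma> \<and> holds_scalars \<sigma> \<and> (\<forall>a\<in>{5, 6, 7}. imem \<sigma> a = imem \<sigma>0 a)"
  let ?I = "\<lambda>y \<sigma>. ?F \<sigma> \<and> imem \<sigma> 3 4 = int y \<and> recorded b y (imem \<sigma> 2)"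
  show "achieves B (For 4 (IMul (IMul size_exp size_exp) (scalar 0))
        (Cond ?test (Seq (IWrite 2 (IConst 1) ?u) (Seq (IWrite 2 (IConst 2) ?v)
          (Seq (IWrite 2 (IConst 3) ?x) (IWrite 2 (IConst 0) (IConst 1))))) Skip))
      \<sigma>0 (12 * (n * n * s) + 3) (maximum_triangle_output E w)"
  proof (rule achieves_For[where N = "n * n * s" and T = 8 and Inv = ?I])
    show "?I 0 (iwrite 3 4 0 \<sigma>0)" using pre by (simp add: prepared_def recorded_def)
    show "imem \<sigma> 3 4 = int y \<and> ival (IMul (IMul size_exp size_exp) (scalar 0)) \<sigma> = int (n * n * s)" if "?I y \<sigma>" for y \<sigma>
      using that by (simp add: holds_graph_def holds_scalars_def)
    show "int (n * n * s) \<le> B" by (rule B_ge(3)) simp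
    show "n * n * s * (8 + 4) + 3 \<le> 12 * (n * n * s) + 3" by simp
    show "maximum_triangle_output E w \<sigma>" if "?I (n * n * s) \<sigma>" for \<sigma>
      using recorded_output[OF lg] that by blast
    fix y \<sigma> assume y: "y < n * n * s" and inv: "?I y \<sigma>"
    define u where "u = first_vertex y"
    define v where "v = second_vertex y"
    have q: "y div s < n * n" using y by (simp add: less_mult_imp_div_less)
    then have n0: "n > 0" by (cases n) auto
    have s0: "s > 0" using y by (cases s) auto
    have uv: "u < n" "v < n" using q n0 by (simp_all add: u_def v_def first_vertex_def second_vertex_def less_mult_imp_div_less)
    have quv: "int y div int s = int u * int n + int v"
    proof -
      have "y div s = u * n + v" by (simp add: u_def v_def first_vertex_def second_vertex_def)
      then have "int (y div s) = int (u * n + v)" by (rule arg_cong)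
      then show ?thesis by (simp add: zdiv_int)
    qed
    have val_u: "ival ?u \<sigma> = int u" and val_v: "ival ?v \<sigma> = int v"
      using inv quv uv(2) by (simp_all add: holds_graph_def holds_scalars_def)
    have val_g: "ival ?g \<sigma> = int (b u v)"
      using inv b(1)[OF uv] val_u val_v by (simp add: holds_scalars_def)
    \<comment> \<open>The program subtracts integers and \<open>third_rank\<close> subtracts
      naturals; they agree when b is positive.\<close>
    have val_r: "ival ?r \<sigma> = int (third_rank b y)" if "b u v > 0"
    proof -
      have "ival ?r \<sigma> = (int (b u v) - 1) * int s + int (y mod s)"
        using val_g inv by (simp add: holds_scalars_def zmod_int)
      also have "int (b u v) - 1 = int (b u v - 1)" using that by simp
      finally show ?thesis by (simp add: third_rank_def u_def v_def)
    qed
    have adj: "ival (IRead 6 (IAdd (IMul ?u (scalar 5)) ?r)) \<sigma> = of_bool (rank_adjacent u (third_rank b y))"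
        "ival (IRead 6 (IAdd (IMul ?v (scalar 5)) ?r)) \<sigma> = of_bool (rank_adjacent v (third_rank b y))"
      if "b u v > 0"
    proof -
      have "third_rank b y < N"
        unfolding third_rank_def N_def u_def[symmetric] v_def[symmetric]
        using b(2)[OF uv] that s0 by (intro row_major_less) auto
      then have "imem \<sigma>0 6 (int u * int N + int (third_rank b y)) = of_bool (rank_adjacent u (third_rank b y))"
        "imem \<sigma>0 6 (int v * int N + int (third_rank b y)) = of_bool (rank_adjacent v (third_rank b y))"
        using pre(1) uv n_le_N unfolding prepared_def holds_columns_def by simp_all
      moreover have gen: "ival (IRead 6 (IAdd (IMul e (scalar 5)) r)) \<sigma> = imem \<sigma>0 6 (ival e \<sigma> * int N + ival r \<sigma>)" for e r
        using inv by (simp add: holds_scalars_def)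
      ultimately show "ival (IRead 6 (IAdd (IMul ?u (scalar 5)) ?r)) \<sigma> = of_bool (rank_adjacent u (third_rank b y))"
        "ival (IRead 6 (IAdd (IMul ?v (scalar 5)) ?r)) \<sigma> = of_bool (rank_adjacent v (third_rank b y))"
        unfolding gen val_u val_v val_r[OF that] by blast+
    qed
    have edge: "ival (IRead 1 (IDiv (scalar 4) (scalar 0))) \<sigma> = of_bool ({u, v} \<in> E)"
      using inv quv uv by (simp add: holds_graph_def holds_scalars_def)
    let ?out_weight = "rmem \<sigma> 0 (imem \<sigma> 2 1) + rmem \<sigma> 0 (imem \<sigma> 2 2) + rmem \<sigma> 0 (imem \<sigma> 2 3)"
    let ?x_weight = "rmem \<sigma> 0 (ival ?u \<sigma>) + rmem \<sigma> 0 (ival ?v \<sigma>) + rmem \<sigma> 0 (ival ?x \<sigma>)"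
    have test: "bval ?test \<sigma> \<longleftrightarrow> candidate b y \<and> \<not> (1 \<le> imem \<sigma> 2 0 \<and> ?x_weight \<le> ?out_weight)"
    proof -
      have "bval ?test \<sigma> \<longleftrightarrow> 1 \<le> ival (IRead 1 (IDiv (scalar 4) (scalar 0))) \<sigma> \<and> 1 \<le> ival ?g \<sigma> \<and>
          1 \<le> ival (IRead 6 (IAdd (IMul ?u (scalar 5)) ?r)) \<sigma> \<and>
          1 \<le> ival (IRead 6 (IAdd (IMul ?v (scalar 5)) ?r)) \<sigma> \<and>
          \<not> (1 \<le> imem \<sigma> 2 0 \<and> ?x_weight \<le> ?out_weight)"
        unfolding bval.simps rval.simps ival.simps(1) ival.simps(2)[of 2] by (rule refl)
      \<comment> \<open>If b is 0, both sides are false whatever the reads of array 6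
        return.\<close>
      also have "\<dots> \<longleftrightarrow> candidate b y \<and> \<not> (1 \<le> imem \<sigma> 2 0 \<and> ?x_weight \<le> ?out_weight)"
        unfolding edge val_g candidate_def u_def[symmetric] v_def[symmetric]
        by (cases "b u v > 0") (simp_all only: adj, auto)
      finally show ?thesis .
    qed
    have third: "ival ?x \<sigma> = int (third_vertex b y)" "third_vertex b y < n" if c: "candidate b y"
    proof -
      have "b u v > 0" using c by (simp add: candidate_def u_def v_def)
      have "ival ?x \<sigma> = imem \<sigma>0 5 (int (third_rank b y))"
        unfolding ival.simps(2)[of 5] val_r[OF \<open>b u v > 0\<close>] using inv by simp
      also have "\<dots> = int (third_vertex b y)"
        using pre(1) candidate_third(1,2)[OF c] unfolding prepared_def holds_order_def by metis
      finally show "ival ?x \<sigma> = int (third_vertex b y)" .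
      show "third_vertex b y < n" by (rule candidate_third) fact
    qed
    have x_weight: "?x_weight = candidate_weight b y" if "candidate b y"
      unfolding third(1)[OF that] val_u val_v candidate_weight_def u_def[symmetric] v_def[symmetric]
      using inv uv third(2)[OF that] by (simp add: holds_graph_def)
    have out_weight: "?out_weight = w (nat (imem \<sigma> 2 1)) + w (nat (imem \<sigma> 2 2)) + w (nat (imem \<sigma> 2 3))"
      if one: "imem \<sigma> 2 0 = 1"
    proof -
      obtain t where t: "candidate b t" "imem \<sigma> 2 1 = int (first_vertex t)" "imem \<sigma> 2 2 = int (second_vertex t)"
        "imem \<sigma> 2 3 = int (third_vertex b t)"
        using inv one unfolding recorded_def by auto
      have "first_vertex t < n" "second_vertex t < n" "third_vertex b t < n"
        using t(1) edge_less[of "first_vertex t" "second_vertex t"] candidate_third(1)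
        by (simp_all add: candidate_def)
      then show ?thesis using inv t(2-4) by (simp add: holds_graph_def)
    qed
    have out0: "1 \<le> imem \<sigma> 2 0 \<longleftrightarrow> imem \<sigma> 2 0 = 1" using inv unfolding recorded_def by auto
    show "achieves B (Cond ?test (Seq (IWrite 2 (IConst 1) ?u) (Seq (IWrite 2 (IConst 2) ?v)
          (Seq (IWrite 2 (IConst 3) ?x) (IWrite 2 (IConst 0) (IConst 1))))) Skip) \<sigma> 8
        (\<lambda>\<sigma>'. imem \<sigma>' 3 4 = int y \<and> ?I (Suc y) (iwrite 3 4 (int (Suc y)) \<sigma>'))"
    proof (rule achieves_Cond[where T = 7])
      assume "bval ?test \<sigma>"
      then have cand: "candidate b y" and nle: "\<not> (1 \<le> imem \<sigma> 2 0 \<and> ?x_weight \<le> ?out_weight)"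
        using test by blast+
      let ?\<sigma>1 = "iwrite 2 1 (int u) \<sigma>"
      let ?\<sigma>2 = "iwrite 2 2 (int v) ?\<sigma>1"
      let ?\<sigma>3 = "iwrite 2 3 (int (third_vertex b y)) ?\<sigma>2"
      let ?\<sigma>4 = "iwrite 2 0 1 ?\<sigma>3"
      have v1: "ival ?v ?\<sigma>1 = int v" using val_v by simp
      have v2: "ival ?x ?\<sigma>2 = int (third_vertex b y)" using third(1)[OF cand] by simp
      have "recorded b (Suc y) (imem ?\<sigma>4 2)"
      proof (rule recorded_update)
        show "recorded b y (imem \<sigma> 2)" using inv by blast
        show "candidate b y" by (rule cand)
        show "w (nat (imem \<sigma> 2 1)) + w (nat (imem \<sigma> 2 2)) + w (nat (imem \<sigma> 2 3)) < candidate_weight b y"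
          if "imem \<sigma> 2 0 = 1"
          using nle that unfolding x_weight[OF cand] out_weight[OF that] by simp
      qed (simp_all add: u_def v_def)
      then have post: "imem ?\<sigma>4 3 4 = int y \<and> ?I (Suc y) (iwrite 3 4 (int (Suc y)) ?\<sigma>4)" using inv by simp
      have le: "int u \<le> B" "int v \<le> B" "int (third_vertex b y) \<le> B" "1 \<le> B"
        using uv third(2)[OF cand] B(2) n0 by linarith+
      show "achieves B (Seq (IWrite 2 (IConst 1) ?u) (Seq (IWrite 2 (IConst 2) ?v)
          (Seq (IWrite 2 (IConst 3) ?x) (IWrite 2 (IConst 0) (IConst 1))))) \<sigma> 7
        (\<lambda>\<sigma>'. imem \<sigma>' 3 4 = int y \<and> ?I (Suc y) (iwrite 3 4 (int (Suc y)) \<sigma>'))"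
      proof (rule achieves_IWrite_Seq[where U = 5], goal_cases)
        case 1
        then show ?case unfolding val_u using le by simp
      next
        case 2
        show ?case unfolding val_u ival.simps(1)
        proof (rule achieves_IWrite_Seq[where U = 3], goal_cases)
          case 1
          then show ?case unfolding v1 using le by simp
        next
          case 2
          show ?case unfolding v1 ival.simps(1)
          proof (rule achieves_IWrite_Seq[where U = 1], goal_cases)
            case 1
            then show ?case unfolding v2 using le by simp
          next
            case 2
            show ?case unfolding v2 ival.simps(1)
              by (rule achieves_IWrite; (unfold ival.simps(1))?) (use le post in simp_all)
          qed simp
        qed simp
      qed simp
    next
      assume "\<not> bval ?test \<sigma>"
      then have "candidate b y \<Longrightarrow> imem \<sigma> 2 0 = 1 \<and> ?x_weight \<le> ?out_weight"
        using test out0 by blast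
      then have "recorded b (Suc y) (imem \<sigma> 2)"
        using inv x_weight out_weight by (intro recorded_skip) auto
      then show "achieves B Skip \<sigma> 7
        (\<lambda>\<sigma>'. imem \<sigma>' 3 4 = int y \<and> ?I (Suc y) (iwrite 3 4 (int (Suc y)) \<sigma>'))"
        using inv by (intro achieves_Skip) simp
    qed simp
  qed
qed

section \<open>The whole program\<close>

lemma graph_input_holds:
  "holds_graph (graph_input n E w)" "blank 4 (graph_input n E w)" "imem (graph_input n E w) 3 c = 0"
proof -
  have "imem (graph_input n E w) 1 (int u * int n + int v) = of_bool ({u, v} \<in> E)" if "u < n" "v < n" for u v
  proof -
    have "u * n + v < n * n" using that by (rule row_major_less)
    moreover have "int u * int n + int v = int (u * n + v)" by simp
    moreover have "(u * n + v) div n = u" "(u * n + v) mod n = v" using that by simp_all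
    ultimately show ?thesis by (simp only: graph_input_def state.simps nat_int of_nat_less_iff) simp
  qed
  then show "holds_graph (graph_input n E w)"
    unfolding holds_graph_def by (simp add: graph_input_def)
qed (simp_all add: graph_input_def blank_def)

text \<open>The bound is the sum over the six phases, plus 5 for sequencing them.\<close>

lemma program_correct:
  "achieves B (max_triangle_program D M) (graph_input n E w)
     (11 * n + 11 * (n * n) + 12 * (n * n * s) + K * (13 * N + TM + 14) + 30)
     (maximum_triangle_output E w)"
proof -
  note gi = graph_input_holds
  have 1: "achieves B (set_scalars D) (graph_input n E w) (6 * n + 10)
      (\<lambda>\<sigma>. holds_graph \<sigma> \<and> blank 4 \<sigma> \<and> holds_scalars \<sigma>)"
    by (rule set_scalars_correct) (use gi in auto)
  show ?thesis
    unfolding max_triangle_program_def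
    apply (rule achieves_Seq[OF 1])
     apply (rule achieves_Seq[OF compute_ranks_correct])
        apply blast
       apply blast
      apply blast
     apply (rule achieves_Seq[OF invert_ranks_correct])
          apply blast
         apply blast
        apply blast
       apply blast
      apply (rule achieves_Seq[OF permute_columns_correct])
            apply blast
           apply blast
          apply blast
         apply blast
        apply blast
       apply (rule achieves_Seq[OF find_groups_correct])
             apply blast
            apply blast
           apply blast
          apply blast
         apply blast
        apply (rule scan_groups_correct)
         apply blast
        apply blast
       apply (rule order_refl)+
    apply simp
    done
qed

end

section \<open>Running times\<close>

text \<open>Each step writes at most one cell. This serves the lower bound on the time of matrix
  multiplication.\<close>

lemma exec_changed_cells:
  "exec B c \<sigma> t \<sigma>' \<Longrightarrow> \<exists>F. finite F \<and> card F \<le> t \<and> (\<forall>i. i \<notin> F \<longrightarrow> rmem \<sigma>' a i = rmem \<sigma> a i)"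
proof (induction rule: exec.induct)
  case (exec_RWrite a' i e s)
  show ?case by (rule exI[of _ "{ival i s}"]) auto
next
  case (exec_Seq c s t s' d u s'')
  then obtain F G where "finite F" "card F \<le> t" "\<forall>i. i \<notin> F \<longrightarrow> rmem s' a i = rmem s a i"
    "finite G" "card G \<le> u" "\<forall>i. i \<notin> G \<longrightarrow> rmem s'' a i = rmem s' a i" by blast
  then show ?case using card_Un_le[of F G] by (intro exI[of _ "F \<union> G"]) auto
next
  case (exec_While_True b s c t s' u s'')
  then obtain F G where "finite F" "card F \<le> t" "\<forall>i. i \<notin> F \<longrightarrow> rmem s' a i = rmem s a i"
    "finite G" "card G \<le> u" "\<forall>i. i \<notin> G \<longrightarrow> rmem s'' a i = rmem s' a i" by blast
  then show ?case using card_Un_le[of F G] by (intro exI[of _ "F \<union> G"]) auto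
next
  case (exec_Cond b s c d t s')
  then show ?case using le_Suc_eq by auto
qed (auto intro!: exI[of _ "{}"])

text \<open>
  All \<open>n\<^sup>2\<close> entries of the product of two all-ones matrices are nonzero, so each of them is written.
\<close>

lemma matrix_product_time_ge:
  fixes n :: nat
  defines "J \<equiv> mat n n (\<lambda>_. 1 :: real)"
  assumes "exec B M (matrix_input n J J) t \<tau>" "matrix_output n (J * J) \<tau>"
  shows "n * n \<le> t"
proof -
  obtain F where F: "finite F" "card F \<le> t" "\<And>i. i \<notin> F \<Longrightarrow> rmem \<tau> 2 i = rmem (matrix_input n J J) 2 i"
    using exec_changed_cells[OF assms(2)] by blast
  have "int ` {..<n * n} \<subseteq> F"
  proof (rule ccontr)
    assume "\<not> ?thesis"
    then obtain k where k: "k < n * n" "int k \<notin> F" by auto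
    then have n0: "n > 0" by (cases n) auto
    let ?i = "k div n" and ?j = "k mod n"
    have ij: "?i < n" "?j < n" using k n0 by (simp_all add: less_mult_imp_div_less)
    have "rmem \<tau> 2 (int (?i * n + ?j)) = (J * J) $$ (?i, ?j)"
      using assms(3) ij unfolding matrix_output_def by blast
    also have "\<dots> = real n" using ij by (simp add: J_def scalar_prod_def)
    finally have "rmem \<tau> 2 (int k) = real n" by simp
    moreover have "rmem \<tau> 2 (int k) = 0" using F(3)[OF k(2)] by (simp add: matrix_input_def)
    ultimately show False using n0 by simp
  qed
  then have "card (int ` {..<n * n}) \<le> card F" using F(1) by (intro card_mono)
  then show ?thesis using F(2) by (simp add: card_image)
qed

text \<open>The bound will be applied at s, which may be small; so the finitely many ratios below n0
  are added to the constant.\<close>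

lemma bigo_powr_bound:
  fixes f :: "nat \<Rightarrow> real"
  assumes "f \<in> O(\<lambda>n. real n powr \<omega>)" "\<And>n. 0 \<le> f n"
  obtains C where "C \<ge> 0" "\<And>n. n \<ge> 1 \<Longrightarrow> f n \<le> C * real n powr \<omega>"
proof -
  obtain c n0 where c: "c > 0" "\<And>n. n \<ge> n0 \<Longrightarrow> norm (f n) \<le> c * norm (real n powr \<omega>)"
    using assms(1) by (elim landau_o.bigE) (auto simp: eventually_sequentially)
  define C where "C = c + (\<Sum>n<n0. f n / real n powr \<omega>)"
  have S: "0 \<le> (\<Sum>n<n0. f n / real n powr \<omega>)" using assms(2) by (intro sum_nonneg) auto
  show ?thesis
  proof
    show "C \<ge> 0" using c(1) S by (simp add: C_def)
    fix n :: nat assume n: "n \<ge> 1"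
    show "f n \<le> C * real n powr \<omega>"
    proof (cases "n < n0")
      case True
      then have "f n / real n powr \<omega> \<le> (\<Sum>n<n0. f n / real n powr \<omega>)"
        using assms(2) by (intro member_le_sum) auto
      then have "f n / real n powr \<omega> \<le> C" using c(1) by (simp add: C_def)
      then show ?thesis using n by (simp add: pos_divide_le_eq)
    next
      case False
      then have "f n \<le> c * real n powr \<omega>" using c(2)[of n] assms(2)[of n] by simp
      also have "\<dots> \<le> C * real n powr \<omega>" using S by (intro mult_right_mono) (auto simp: C_def)
      finally show ?thesis .
    qed
  qed
qed

lemma matrix_mult_exponentE:
  assumes "matrix_mult_exponent \<omega>"
  obtains M k TM C where "arithmetic M"
    "\<And>n X Y. X \<in> carrier_mat n n \<Longrightarrow> Y \<in> carrier_mat n n \<Longrightarrow>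
      \<exists>t \<tau>. exec ((int n + 2) ^ k) M (matrix_input n X Y) t \<tau> \<and> t \<le> TM n \<and> matrix_output n (X * Y) \<tau>"
    "C \<ge> 0" "\<And>n. n \<ge> 1 \<Longrightarrow> real (TM n) \<le> C * real n powr \<omega>"
proof -
  define inputs where "inputs n = {matrix_input n A B | A B. A \<in> carrier_mat n n \<and> B \<in> carrier_mat n n}" for n
  obtain M where M: "arithmetic M"
    "\<And>n A B. A \<in> carrier_mat n n \<Longrightarrow> B \<in> carrier_mat n n \<Longrightarrow>
       always_yields M (matrix_input n A B) (matrix_output n (A * B))"
    "runs_in_expected_time M inputs (\<lambda>n. real n powr \<omega>)"
    using assms unfolding matrix_mult_exponent_def inputs_def by blast
  from M(3) obtain k where k: "\<And>n s. s \<in> inputs n \<Longrightarrow> words_bounded ((int n + 2) ^ k) M s"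
    and fin: "\<And>n. worst_case_expected_time M inputs n < \<infinity>"
    and O: "(\<lambda>n. enn2real (worst_case_expected_time M inputs n)) \<in> O(\<lambda>n. real n powr \<omega>)"
    unfolding runs_in_expected_time_def by blast
  obtain C where C: "C \<ge> 0" "\<And>n. n \<ge> 1 \<Longrightarrow> enn2real (worst_case_expected_time M inputs n) \<le> C * real n powr \<omega>"
    using bigo_powr_bound[OF O] by auto
  \<comment> \<open>Halting times are natural numbers, so rounding down loses nothing.\<close>
  define TM where "TM n = nat \<lfloor>enn2real (worst_case_expected_time M inputs n)\<rfloor>" for n
  have det: "deterministic M" using M(1) by (rule arithmetic_deterministic)
  show ?thesis
  proof (rule that[OF M(1) _ C(1)])
    fix n :: nat and X Y :: "real mat" assume XY: "X \<in> carrier_mat n n" "Y \<in> carrier_mat n n"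
    let ?s = "matrix_input n X Y"
    have s: "?s \<in> inputs n" using XY unfolding inputs_def by blast
    have le: "expected_time M ?s \<le> worst_case_expected_time M inputs n"
      unfolding worst_case_expected_time_def using s by (rule SUP_upper)
    have fin': "expected_time M ?s < \<infinity>" using le fin[of n] by (rule le_less_trans)
    obtain t \<tau> where t: "exec ((int n + 2) ^ k) M ?s t \<tau>"
      using finite_time_imp_exec[OF det fin' k[OF s]] .
    have "real t \<le> enn2real (worst_case_expected_time M inputs n)"
      using enn2real_mono[OF le[unfolded exec_imp_time[OF det t]]] fin[of n] by simp
    then have "t \<le> TM n" by (simp add: TM_def le_nat_iff le_floor_iff)
    moreover have "matrix_output n (X * Y) \<tau>"
      using M(2)[OF XY] exec_reachable[OF det t] unfolding always_yields_def by blast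
    ultimately show "\<exists>t \<tau>. exec ((int n + 2) ^ k) M ?s t \<tau> \<and> t \<le> TM n \<and> matrix_output n (X * Y) \<tau>"
      using t by blast
  next
    fix n :: nat assume "n \<ge> 1"
    have "real (TM n) \<le> enn2real (worst_case_expected_time M inputs n)"
      by (simp add: TM_def)
    then show "real (TM n) \<le> C * real n powr \<omega>" using C(2)[OF \<open>n \<ge> 1\<close>] by linarith
  qed
qed

text \<open>For a smaller exponent, \<open>n powr (2 - \<omega>)\<close> would be unbounded,
  although the two hypotheses bound it by C.\<close>

lemma exponent_ge_2:
  fixes TM :: "nat \<Rightarrow> nat"
  assumes "\<And>n. n * n \<le> TM n" "\<And>n. n \<ge> 1 \<Longrightarrow> real (TM n) \<le> C * real n powr \<omega>"
  shows "\<omega> \<ge> 2"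
proof (rule ccontr)
  assume "\<not> \<omega> \<ge> 2"
  then have "filterlim (\<lambda>n. real n powr (2 - \<omega>)) at_top sequentially" by real_asymp
  then have "eventually (\<lambda>n. real n powr (2 - \<omega>) \<ge> C + 1) sequentially"
    by (simp add: filterlim_at_top)
  then obtain n where n: "n \<ge> 1" "real n powr (2 - \<omega>) \<ge> C + 1"
    by (metis eventually_sequentially le_add1 le_add2)
  have "real n powr (2 - \<omega>) * real n powr \<omega> = real (n * n)"
    using n(1) by (simp flip: powr_add add: powr_numeral power2_eq_square)
  also have "\<dots> \<le> real (TM n)" using assms(1)[of n] by (simp only: of_nat_le_iff)
  also have "\<dots> \<le> C * real n powr \<omega>" by (rule assms(2)[OF n(1)])
  finally have "real n powr (2 - \<omega>) \<le> C" using n(1) by simp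
  then show False using n(2) by simp
qed

text \<open>Minimality gives (s - 1)^2 < n, hence s \<le> 2 sqrt n, the source of 32 = 2^5 and of
  \<open>2 powr (\<omega> + 3)\<close>. All terms without \<open>TM\<close> are absorbed into s^5,
  and 91 = 11 + 11 + 12 + 13 + 14 + 30.\<close>

lemma total_time_bound:
  fixes n s TM :: nat
  assumes n: "n \<ge> 1" and s: "n \<le> s * s" "\<And>t. t < s \<Longrightarrow> t * t < n"
    and \<omega>: "\<omega> \<ge> 2" and TM: "real TM \<le> C * real s powr \<omega>" "C \<ge> 0"
  shows "real (11 * n + 11 * (n * n) + 12 * (n * n * s) + s * s * s * (13 * (s * s) + TM + 14) + 30)
    \<le> (91 * 32 + C * 2 powr (\<omega> + 3)) * real n powr ((\<omega> + 3) / 2)"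
proof -
  have s1: "s \<ge> 1" using n s(1) by (cases s) auto
  have "real s \<le> 2 * sqrt (real n)"
  proof -
    have "real ((s - 1) * (s - 1)) < real n" using s(2)[of "s - 1"] s1 by (simp only: of_nat_less_iff)
    then have "(real (s - 1))\<^sup>2 < real n" by (simp add: power2_eq_square)
    then have "real (s - 1) < sqrt (real n)" by (simp add: real_less_rsqrt)
    moreover have "1 \<le> sqrt (real n)" using n by simp
    moreover have "real s = real (s - 1) + 1" using s1 by simp
    ultimately show ?thesis by linarith
  qed
  then have s_le: "real s \<le> 2 * real n powr (1/2)" by (simp add: powr_half_sqrt)
  have pow: "real s powr p \<le> 2 powr p * real n powr (p / 2)" if "p \<ge> 0" for p
  proof -
    have "real s powr p \<le> (2 * real n powr (1/2)) powr p" using s_le that by (intro powr_mono2) auto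
    then show ?thesis by (simp add: powr_mult powr_powr)
  qed
  have "real s powr 5 \<le> 2 powr 5 * real n powr (5 / 2)" using pow[of 5] by simp
  also have "real n powr (5 / 2) \<le> real n powr ((\<omega> + 3) / 2)" using n \<omega> by (intro powr_mono) auto
  finally have s5: "real s ^ 5 \<le> 32 * real n powr ((\<omega> + 3) / 2)"
    using s1 by (simp add: powr_numeral)
  have "real s ^ 3 * real TM \<le> real s powr 3 * (C * real s powr \<omega>)"
    using TM s1 by (simp add: powr_numeral mult_left_mono)
  also have "\<dots> = C * real s powr (\<omega> + 3)" using s1 by (simp add: powr_add mult_ac)
  also have "\<dots> \<le> C * (2 powr (\<omega> + 3) * real n powr ((\<omega> + 3) / 2))"
    using pow[of "\<omega> + 3"] \<omega> TM(2) by (intro mult_left_mono) auto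
  finally have sTM: "real s ^ 3 * real TM \<le> C * 2 powr (\<omega> + 3) * real n powr ((\<omega> + 3) / 2)"
    by (simp add: mult_ac)
  have mono: "s ^ i \<le> s ^ 5" if "i \<le> 5" for i using s1 that by (intro power_increasing) auto
  have "n \<le> s ^ 2" using s(1) by (simp add: power2_eq_square)
  then have n5: "n \<le> s ^ 5" using mono[of 2] by linarith
  have nn: "n * n \<le> s ^ 4"
  proof -
    have "n * n \<le> s ^ 2 * s ^ 2" using \<open>n \<le> s ^ 2\<close> by (rule mult_le_mono) fact
    then show ?thesis by (simp flip: power_add)
  qed
  then have nns: "n * n * s \<le> s ^ 5"
    using mult_le_mono1[OF nn, of s] by (simp add: numeral_eq_Suc mult_ac)
  have K: "s * s * s * (13 * (s * s) + TM + 14) = 13 * s ^ 5 + s ^ 3 * TM + 14 * s ^ 3"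
    by (simp add: algebra_simps numeral_eq_Suc)
  have "11 * n + 11 * (n * n) + 12 * (n * n * s) + s * s * s * (13 * (s * s) + TM + 14) + 30
      \<le> 91 * s ^ 5 + s ^ 3 * TM"
    unfolding K using n5 nn nns mono[of 4] mono[of 3] mono[of 0] by simp
  then have "real (11 * n + 11 * (n * n) + 12 * (n * n * s) + s * s * s * (13 * (s * s) + TM + 14) + 30)
      \<le> real (91 * s ^ 5 + s ^ 3 * TM)"
    by (simp only: of_nat_le_iff)
  also have "\<dots> = 91 * real s ^ 5 + real s ^ 3 * real TM" by simp
  also have "\<dots> \<le> (91 * 32 + C * 2 powr (\<omega> + 3)) * real n powr ((\<omega> + 3) / 2)"
    using s5 sTM by (simp add: distrib_right)
  finally show ?thesis .
qed

text \<open>The bound must hold for every n, so the constant \<open>D\<close> is absorbed by the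
  exponent: D \<le> 2^D \<le> (n + 2)^D. The summand k accommodates the words of \<open>M\<close>,
  and 4 leaves room for n^3.\<close>

lemma word_bounds:
  fixes n s k :: nat and D :: int
  assumes "D > 0" "s \<le> n"
  defines "B \<equiv> (int n + 2) ^ (k + nat D + 4)"
  shows "int (n * n * n) \<le> B" "int n \<le> B" "D * int s + 1 \<le> B" "(int s + 2) ^ k \<le> B" "1 \<le> B"
proof -
  let ?b = "int n + 2"
  have mono: "?b ^ i \<le> B" if "i \<le> k + nat D + 4" for i
    unfolding B_def using that by (intro power_increasing) auto
  have "int (n * n * n) \<le> ?b ^ 3" by (simp add: power3_eq_cube mult_mono)
  then show "int (n * n * n) \<le> B" using mono[of 3] by linarith
  show "int n \<le> B" using mono[of 1] by simp
  show "1 \<le> B" using mono[of 0] by simp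
  have "(int s + 2) ^ k \<le> ?b ^ k" using assms(2) by (intro power_mono) auto
  then show "(int s + 2) ^ k \<le> B" using mono[of k] by linarith
  have "int (nat D) < 2 ^ nat D" by (rule of_nat_less_two_power)
  then have "D \<le> 2 ^ nat D" using assms(1) by simp
  also have "(2::int) ^ nat D \<le> ?b ^ nat D" by (intro power_mono) auto
  finally have D: "D \<le> ?b ^ nat D" .
  have "D * int s + 1 \<le> D * int n + D" using assms(1,2) by (intro add_mono mult_left_mono) auto
  also have "\<dots> \<le> D * ?b" using assms(1) by (simp add: distrib_left)
  also have "\<dots> \<le> ?b ^ nat D * ?b" using D by (intro mult_right_mono) auto
  also have "\<dots> = ?b ^ (nat D + 1)" by simp
  also have "\<dots> \<le> B" by (rule mono) simp
  finally show "D * int s + 1 \<le> B" .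
qed

theorem theorem2p3:
  fixes \<omega> :: real
  assumes "matrix_mult_exponent \<omega>"
  shows "\<exists>P. comparison_addition P \<and>
    (\<forall>n E w. simple_graph n E \<longrightarrow>
       always_yields P (graph_input n E w) (maximum_triangle_output E w)) \<and>
    runs_in_expected_time P
      (\<lambda>n. {graph_input n E w | E w. simple_graph n E})
      (\<lambda>n. real n powr ((\<omega> + 3) / 2) * ln (real n))"
proof -
  obtain M k TM C where M: "arithmetic M"
    and M_exec: "\<And>n X Y. X \<in> carrier_mat n n \<Longrightarrow> Y \<in> carrier_mat n n \<Longrightarrow>
      \<exists>t \<tau>. exec ((int n + 2) ^ k) M (matrix_input n X Y) t \<tau> \<and> t \<le> TM n \<and> matrix_output n (X * Y) \<tau>"
    and C: "C \<ge> 0" "\<And>n. n \<ge> 1 \<Longrightarrow> real (TM n) \<le> C * real n powr \<omega>"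
    using matrix_mult_exponentE[OF assms] by metis
  have "n * n \<le> TM n" for n
  proof -
    let ?J = "mat n n (\<lambda>_. 1 :: real)"
    obtain t \<tau> where "exec ((int n + 2) ^ k) M (matrix_input n ?J ?J) t \<tau>" "t \<le> TM n" "matrix_output n (?J * ?J) \<tau>"
      using M_exec[of ?J n ?J] by auto
    then show ?thesis using matrix_product_time_ge by (meson le_trans)
  qed
  then have \<omega>: "\<omega> \<ge> 2" using C(2) by (rule exponent_ge_2)
  obtain D where D: "D > 0" "clears D M" using ex_clears by blast
  define P where "P = max_triangle_program D M"
  define s where "s n = (LEAST s. n \<le> s * s)" for n :: nat
  define T where "T n = 11 * n + 11 * (n * n) + 12 * (n * n * s n) +
    s n * s n * s n * (13 * (s n * s n) + TM (s n) + 14) + 30" for n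
  define inputs where "inputs n = {graph_input n E w | E w. simple_graph n E}" for n
  define B where "B n = (int n + 2) ^ (k + nat D + 4)" for n
  have det: "deterministic P" unfolding P_def by (rule deterministic_program)
  have P_exec: "\<exists>t \<sigma>. exec (B n) P (graph_input n E w) t \<sigma> \<and> t \<le> T n \<and> maximum_triangle_output E w \<sigma>"
    and words: "words_le (B n) (graph_input n E w)"
    if E: "simple_graph n E" for n E w
  proof -
    interpret weighted_graph n E w by unfold_locales (fact E)
    have s_eq: "s n = groups" by (simp add: s_def groups_def)
    note wb = word_bounds[OF D(1) groups_le_n, of k, folded B_def s_eq]
    interpret triangle_search n E w D "D * int (s n) + 1" "B n" "(int (s n) + 2) ^ k" M "TM (s n)" "s n"
      "s n * s n" "s n * s n * s n"
      by unfold_locales (use D M M_exec s_eq wb in auto)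
    show "\<exists>t \<sigma>. exec (B n) P (graph_input n E w) t \<sigma> \<and> t \<le> T n \<and> maximum_triangle_output E w \<sigma>"
      using program_correct unfolding achieves_def P_def T_def by blast
    show "words_le (B n) (graph_input n E w)"
      using wb(2,5) by (auto simp: words_le_def graph_input_def)
  qed
  have yields: "always_yields P (graph_input n E w) (maximum_triangle_output E w)" if E: "simple_graph n E" for n E w
  proof -
    obtain t \<sigma> where "exec (B n) P (graph_input n E w) t \<sigma>" "maximum_triangle_output E w \<sigma>"
      using P_exec[OF E] by blast
    then show ?thesis unfolding always_yields_def using exec_imp_reachable(1)[OF det] by blast
  qed
  have bounded: "words_bounded ((int n + 2) ^ (k + nat D + 4)) P \<sigma>" if in_n: "\<sigma> \<in> inputs n" for n \<sigma>
  proof -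
    obtain E w where E: "\<sigma> = graph_input n E w" "simple_graph n E" using in_n unfolding inputs_def by blast
    obtain t \<sigma>' where "exec (B n) P \<sigma> t \<sigma>'" using P_exec[OF E(2)] E(1) by blast
    from exec_imp_reachable(2)[OF det this _ words[OF E(2), of w, folded E(1)]]
    show ?thesis by (auto simp: words_bounded_def words_le_def B_def)
  qed
  have time: "worst_case_expected_time P inputs n \<le> of_nat (T n)" for n
    unfolding worst_case_expected_time_def
  proof (rule SUP_least)
    fix \<sigma> assume "\<sigma> \<in> inputs n"
    then obtain E w where E: "\<sigma> = graph_input n E w" "simple_graph n E" unfolding inputs_def by blast
    obtain t \<sigma>' where "exec (B n) P \<sigma> t \<sigma>'" "t \<le> T n" using P_exec[OF E(2)] E(1) by blast
    then show "expected_time P \<sigma> \<le> of_nat (T n)" using exec_imp_time[OF det] by simp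
  qed
  have fin: "worst_case_expected_time P inputs n < \<infinity>" for n
    using time[of n] by (rule le_less_trans) (simp add: of_nat_less_top)
  have "(\<lambda>n. enn2real (worst_case_expected_time P inputs n)) \<in> O(\<lambda>n. real n powr ((\<omega> + 3) / 2) * ln (real n))"
  proof (rule bigoI[where c = "91 * 32 + C * 2 powr (\<omega> + 3)"])
    show "eventually (\<lambda>n. norm (enn2real (worst_case_expected_time P inputs n)) \<le>
      (91 * 32 + C * 2 powr (\<omega> + 3)) * norm (real n powr ((\<omega> + 3) / 2) * ln (real n))) sequentially"
      \<comment> \<open>From 3 on the logarithm is at least 1, since e \<le> 3.\<close>
      using eventually_ge_at_top[of 3]
    proof eventually_elim
      case (elim n)
      have sn: "n \<le> s n * s n" unfolding s_def by (rule LeastI[of _ n]) (rule le_square)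
      have sl: "t * t < n" if "t < s n" for t using not_less_Least[OF that[unfolded s_def]] by simp
      have "s n \<ge> 1" using sn elim by (cases "s n") auto
      then have T: "real (T n) \<le> (91 * 32 + C * 2 powr (\<omega> + 3)) * real n powr ((\<omega> + 3) / 2)"
        unfolding T_def using elim sn sl \<omega> C by (intro total_time_bound) auto
      have "exp 1 \<le> real n" using elim exp_le by linarith
      then have ln: "1 \<le> ln (real n)" using elim by (simp add: ln_ge_iff)
      have "enn2real (worst_case_expected_time P inputs n) \<le> enn2real (of_nat (T n))"
        by (rule enn2real_mono[OF time]) (simp add: of_nat_less_top)
      also have "\<dots> = real (T n)" by simp
      also note T
      also have "(91 * 32 + C * 2 powr (\<omega> + 3)) * real n powr ((\<omega> + 3) / 2) \<le>
          (91 * 32 + C * 2 powr (\<omega> + 3)) * (real n powr ((\<omega> + 3) / 2) * ln (real n))"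
        using ln C(1) by (intro mult_left_mono) (auto simp: mult_le_cancel_left1)
      finally show ?case using ln by (simp add: enn2real_nonneg)
    qed
  qed
  then have "runs_in_expected_time P inputs (\<lambda>n. real n powr ((\<omega> + 3) / 2) * ln (real n))"
    unfolding runs_in_expected_time_def using bounded fin by blast
  moreover have "comparison_addition P" unfolding P_def by (rule comparison_addition_program)
  ultimately show ?thesis using yields unfolding inputs_def by blast
qed

end
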